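(* Suppose a preference $\succeq$ on $L^\infty$ is represented by a monotone additive statistic $\Phi(X)=\int_{\overline{\mathbb{R}}}K_a(X)\,\mathrm{d}\mu(a)$, where $\mu$ is a Borel probability measure on $\overline{\mathbb{R}}$. Then $\succeq$ satisfies the betweenness axiom if and only if there exist $\beta\in[0,1]$ and $a\in[0,\infty)$ such that for every $X\in L^\infty$ $$\Phi(X)=\beta K_{-a\beta}(X)+(1-\beta)K_{a(1-\beta)}(X).$$
   Context: $L^\infty$ is the set of bounded real random variables on a fixed nonatomic probability space; $\overline{\mathbb{R}}=\mathbb{R}\cup\{-\infty,\infty\}$. For $a\in\mathbb{R}\setminus\{0\}$, $K_a(X)=\frac1a\log\mathbb{E}[e^{aX}]$; $K_0(X)=\mathbb{E}[X]$; $K_\infty(X)$ and $K_{-\infty}(X)$ are the essential maximum and minimum of $X$. A monotone additive statistic is a map $\Phi\colon L^\infty\to\mathbb{R}$ that depends only on the distribution, satisfies $\Phi(c)=c$ for constants $c$, is additive for sums of independent random variables, and is monotone with respect to first-order stochastic dominance. $\succeq$ is represented by $\Phi$ means: $X\succeq Y$ if and only if $\Phi(X)\ge\Phi(Y)$; $\sim$ denotes indifference. For $\lambda\in(0,1)$, $X_\lambda Y$ denotes any random variable whose distribution is $\lambda$ times the distribution of $X$ plus $1-\lambda$ times the distribution of $Y$. Betweenness axiom: for all $X,Y\in L^\infty$ and all $\lambda\in(0,1)$, $X\sim Y$ if and only if $X_\lambda Y\sim Y$. *)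

theory Defs
  imports "HOL-Probability.Probability" "HOL-Probability.Essential_Supremum"
begin

definition nonatomic :: "'a measure \<Rightarrow> bool" where
  "nonatomic M \<longleftrightarrow>
     (\<forall>A\<in>sets M. measure M A > 0 \<longrightarrow>
        (\<exists>B\<in>sets M. B \<subseteq> A \<and> 0 < measure M B \<and> measure M B < measure M A))"

definition Linf :: "'a measure \<Rightarrow> ('a \<Rightarrow> real) set" where
  "Linf M = {X. X \<in> borel_measurable M \<and> bounded (X ` space M)}"

definition ess_max :: "'a measure \<Rightarrow> ('a \<Rightarrow> real) \<Rightarrow> real" where
  "ess_max M X = real_of_ereal (esssup M (\<lambda>\<omega>. ereal (X \<omega>)))"

definition ess_min :: "'a measure \<Rightarrow> ('a \<Rightarrow> real) \<Rightarrow> real" where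
  "ess_min M X = - ess_max M (\<lambda>\<omega>. - X \<omega>)"

definition K_stat :: "'a measure \<Rightarrow> ereal \<Rightarrow> ('a \<Rightarrow> real) \<Rightarrow> real" where
  "K_stat M a X =
     (if a = \<infinity> then ess_max M X
      else if a = -\<infinity> then ess_min M X
      else if a = 0 then (\<integral>\<omega>. X \<omega> \<partial>M)
      else 1 / real_of_ereal a * ln (\<integral>\<omega>. exp (real_of_ereal a * X \<omega>) \<partial>M))"

definition fosd :: "'a measure \<Rightarrow> ('a \<Rightarrow> real) \<Rightarrow> ('a \<Rightarrow> real) \<Rightarrow> bool" where
  "fosd M X Y \<longleftrightarrow>
     (\<forall>t. measure M {\<omega>\<in>space M. X \<omega> \<le> t} \<le> measure M {\<omega>\<in>space M. Y \<omega> \<le> t})"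

definition monotone_additive_statistic ::
    "'a measure \<Rightarrow> (('a \<Rightarrow> real) \<Rightarrow> real) \<Rightarrow> bool" where
  "monotone_additive_statistic M \<Phi> \<longleftrightarrow>
     (\<forall>X\<in>Linf M. \<forall>Y\<in>Linf M. distr M borel X = distr M borel Y \<longrightarrow> \<Phi> X = \<Phi> Y) \<and>
     (\<forall>c. \<Phi> (\<lambda>_. c) = c) \<and>
     (\<forall>X\<in>Linf M. \<forall>Y\<in>Linf M. prob_space.indep_var M borel X borel Y \<longrightarrow>
        \<Phi> (\<lambda>\<omega>. X \<omega> + Y \<omega>) = \<Phi> X + \<Phi> Y) \<and>
     (\<forall>X\<in>Linf M. \<forall>Y\<in>Linf M. fosd M X Y \<longrightarrow> \<Phi> X \<ge> \<Phi> Y)"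

definition represented_by ::
    "'a measure \<Rightarrow> (('a \<Rightarrow> real) \<Rightarrow> ('a \<Rightarrow> real) \<Rightarrow> bool) \<Rightarrow> (('a \<Rightarrow> real) \<Rightarrow> real) \<Rightarrow> bool" where
  "represented_by M pref \<Phi> \<longleftrightarrow> (\<forall>X\<in>Linf M. \<forall>Y\<in>Linf M. pref X Y \<longleftrightarrow> \<Phi> X \<ge> \<Phi> Y)"

definition indifferent ::
    "(('a \<Rightarrow> real) \<Rightarrow> ('a \<Rightarrow> real) \<Rightarrow> bool) \<Rightarrow> ('a \<Rightarrow> real) \<Rightarrow> ('a \<Rightarrow> real) \<Rightarrow> bool" where
  "indifferent pref X Y \<longleftrightarrow> pref X Y \<and> pref Y X"

definition is_mixture ::
    "'a measure \<Rightarrow> real \<Rightarrow> ('a \<Rightarrow> real) \<Rightarrow> ('a \<Rightarrow> real) \<Rightarrow> ('a \<Rightarrow> real) \<Rightarrow> bool" where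
  "is_mixture M l X Y Z \<longleftrightarrow>
     (\<forall>B\<in>sets borel. measure (distr M borel Z) B =
        l * measure (distr M borel X) B + (1 - l) * measure (distr M borel Y) B)"

(* A mixture is determined only up to its distribution, so the axiom ranges over every
   version Z. On a nonatomic space at least one version exists. *)
definition betweenness ::
    "'a measure \<Rightarrow> (('a \<Rightarrow> real) \<Rightarrow> ('a \<Rightarrow> real) \<Rightarrow> bool) \<Rightarrow> bool" where
  "betweenness M pref \<longleftrightarrow>
     (\<forall>X\<in>Linf M. \<forall>Y\<in>Linf M. \<forall>l\<in>{0<..<1}. \<forall>Z\<in>Linf M. is_mixture M l X Y Z \<longrightarrow>
        (indifferent pref X Y \<longleftrightarrow> indifferent pref Z Y))"

end

theory Submission imports Defs begin

text \<open>Betweenness forces every \<open>X\<close> with \<open>\<Phi> X = 0\<close> to satisfy \<open>\<Phi> Z = 0\<close> for each mixture \<open>Z\<close> of \<open>X\<close> with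
  the constant \<open>0\<close>. Take for \<open>X\<close> a recentred large value of exponentially small probability:
  if \<open>\<mu>\<close> charged both \<open>[0, a1]\<close> and \<open>[a2, \<infinity>]\<close> with \<open>0 < a1 < a2\<close>, mixing with \<open>0\<close> would increase
  \<open>\<Phi>\<close>. So \<open>\<mu>\<close> lives on a single point of \<open>[0, \<infinity>]\<close> and, by the reflection \<open>X \<mapsto> - X\<close>, on a single
  point of \<open>[- \<infinity>, 0]\<close>; hence \<open>\<mu>\<close> is the point mass at \<open>0\<close> or lives on two points \<open>b < 0 < c\<close>. Infinite atoms violate
  betweenness, and for finite ones differentiating
  \<open>\<beta> / b * ln (1 + l * u) + (1 - \<beta>) / c * ln (1 + l * v) = 0\<close> in the mixing weight \<open>l\<close>
  gives \<open>\<beta> * c + (1 - \<beta>) * b = 0\<close>, that is \<open>b = - a * \<beta>\<close> and \<open>c = a * (1 - \<beta>)\<close> for \<open>a = c - b\<close>.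
  Conversely \<open>\<Phi> X = \<Phi> Y\<close> is then, for fixed \<open>Y\<close>, a linear equation in the law of \<open>X\<close>.\<close>

section \<open>Monotonicity and invariance of the statistics\<close>

context prob_space
begin

lemma Linf_boundE:
  assumes "X \<in> Linf M"
  obtains C where "C \<ge> 0" "\<And>\<omega>. \<omega> \<in> space M \<Longrightarrow> \<bar>X \<omega>\<bar> \<le> C"
proof -
  from assms obtain C where "\<forall>x\<in>X ` space M. norm x \<le> C"
    by (auto simp: Linf_def bounded_iff)
  then show thesis
    by (intro that[of "max C 0"]) auto
qed

lemma LinfI:
  assumes "X \<in> borel_measurable M" "\<And>\<omega>. \<omega> \<in> space M \<Longrightarrow> \<bar>X \<omega>\<bar> \<le> C"
  shows "X \<in> Linf M"
  using assms by (auto simp: Linf_def bounded_iff)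

lemma Linf_measurable: "X \<in> Linf M \<Longrightarrow> X \<in> borel_measurable M"
  by (simp add: Linf_def)

lemma Linf_const [simp]: "(\<lambda>_. c) \<in> Linf M"
  by (rule LinfI[where C = "\<bar>c\<bar>"]) auto

lemma Linf_uminus:
  assumes "X \<in> Linf M" shows "(\<lambda>\<omega>. - X \<omega>) \<in> Linf M"
proof -
  obtain C where "\<And>\<omega>. \<omega> \<in> space M \<Longrightarrow> \<bar>X \<omega>\<bar> \<le> C"
    using Linf_boundE[OF assms] by blast
  then show ?thesis
    using Linf_measurable[OF assms] by (intro LinfI[where C = C]) auto
qed

lemma Linf_diff_const:
  assumes "X \<in> Linf M" shows "(\<lambda>\<omega>. X \<omega> - c) \<in> Linf M"
proof -
  obtain C where C: "\<And>\<omega>. \<omega> \<in> space M \<Longrightarrow> \<bar>X \<omega>\<bar> \<le> C"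
    using Linf_boundE[OF assms] by blast
  have "\<bar>X \<omega> - c\<bar> \<le> C + \<bar>c\<bar>" if "\<omega> \<in> space M" for \<omega>
    using C[OF that] by linarith
  then show ?thesis
    using Linf_measurable[OF assms] by (intro LinfI) auto
qed

lemma integrable_Linf: "X \<in> Linf M \<Longrightarrow> integrable M X"
  by (rule Linf_boundE, assumption)
     (rule integrable_const_bound, auto simp: Linf_measurable)

lemma integrable_exp_Linf:
  assumes "X \<in> Linf M" shows "integrable M (\<lambda>\<omega>. exp (a * X \<omega>))"
proof -
  obtain C where C: "\<And>\<omega>. \<omega> \<in> space M \<Longrightarrow> \<bar>X \<omega>\<bar> \<le> C"
    using Linf_boundE[OF assms] by blast
  have "exp (a * X \<omega>) \<le> exp (\<bar>a\<bar> * C)" if "\<omega> \<in> space M" for \<omega>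
  proof -
    have "a * X \<omega> \<le> \<bar>a\<bar> * \<bar>X \<omega>\<bar>"
      by (metis abs_ge_self abs_mult)
    also have "\<dots> \<le> \<bar>a\<bar> * C"
      by (intro mult_left_mono C that) auto
    finally show ?thesis by simp
  qed
  then show ?thesis
    using Linf_measurable[OF assms]
    by (intro integrable_const_bound[where B = "exp (\<bar>a\<bar> * C)"]) auto
qed

lemma expectation_pos:
  assumes "integrable M f" "\<And>\<omega>. \<omega> \<in> space M \<Longrightarrow> (0::real) < f \<omega>"
  shows "0 < expectation f"
  using integral_less_AE_space[of "\<lambda>_. 0" f] assms emeasure_space_1 by simp

section \<open>Moment generating functions and the essential maximum\<close>

abbreviation mgf :: "('a \<Rightarrow> real) \<Rightarrow> real \<Rightarrow> real" where
  "mgf X a \<equiv> expectation (\<lambda>\<omega>. exp (a * X \<omega>))"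

lemma mgf_pos: "X \<in> Linf M \<Longrightarrow> 0 < mgf X a"
  by (rule expectation_pos) (auto intro: integrable_exp_Linf)

lemma K_stat_real: "a \<noteq> 0 \<Longrightarrow> K_stat M (ereal a) X = ln (mgf X a) / a"
  by (simp add: K_stat_def)

lemma K_stat_0: "K_stat M 0 X = expectation X"
  by (simp add: K_stat_def)

lemma K_stat_infty: "K_stat M \<infinity> X = ess_max M X"
  by (simp add: K_stat_def)

text \<open>Moment generating functions are linear in the law, so this identity turns statements
  about K_a into linear ones. At \<open>a = 0\<close> both sides are 1.\<close>

lemma exp_K_stat:
  "X \<in> Linf M \<Longrightarrow> exp (a * K_stat M (ereal a) X) = mgf X a"
  using prob_space by (cases "a = 0") (auto simp: K_stat_real mgf_pos)

text \<open>Boundedness puts the essential supremum between \<open>- C\<close> and \<open>C\<close>,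
  so \<open>real_of_ereal\<close> never returns its default value. Knowing all upper bounds
  \<open>t\<close> determines \<open>ess_max\<close>, which is how the later identities for it are
  proved.\<close>

lemma ess_max_le_iff:
  assumes "X \<in> Linf M"
  shows "ess_max M X \<le> t \<longleftrightarrow> (AE \<omega> in M. X \<omega> \<le> t)"
proof -
  note [measurable] = Linf_measurable[OF assms]
  let ?s = "esssup M (\<lambda>\<omega>. ereal (X \<omega>))"
  obtain C where C: "\<And>\<omega>. \<omega> \<in> space M \<Longrightarrow> \<bar>X \<omega>\<bar> \<le> C"
    using Linf_boundE[OF assms] by blast
  have "?s \<le> ereal C"
    by (rule esssup_I) (use C in \<open>auto simp: abs_le_iff\<close>)
  moreover have "ereal (- C) \<le> ?s"
  proof -
    have "ereal (- C) = esssup M (\<lambda>_. ereal (- C))"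
      by (rule esssup_const[symmetric]) (simp add: emeasure_space_1)
    also have "\<dots> \<le> ?s"
      by (rule esssup_AE_mono) (use C in \<open>auto simp: abs_le_iff minus_le_iff\<close>)
    finally show ?thesis .
  qed
  ultimately have s: "?s = ereal (ess_max M X)"
    unfolding ess_max_def by (cases ?s) auto
  show ?thesis
  proof
    assume "ess_max M X \<le> t"
    then show "AE \<omega> in M. X \<omega> \<le> t"
      using esssup_AE[of "\<lambda>\<omega>. ereal (X \<omega>)" M] s by (auto elim!: eventually_mono)
  next
    assume "AE \<omega> in M. X \<omega> \<le> t"
    then have "?s \<le> ereal t"
      by (intro esssup_I) auto
    then show "ess_max M X \<le> t"
      using s by simp
  qed
qed

lemma ess_max_diff_const:
  assumes "X \<in> Linf M" shows "ess_max M (\<lambda>\<omega>. X \<omega> - c) = ess_max M X - c"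
proof -
  have "ess_max M (\<lambda>\<omega>. X \<omega> - c) \<le> t \<longleftrightarrow> ess_max M X - c \<le> t" for t
    using ess_max_le_iff[OF assms, of "t + c"] ess_max_le_iff[OF Linf_diff_const[OF assms], of c t]
    by (simp add: algebra_simps)
  then show ?thesis
    by (meson antisym order_refl)
qed

text \<open>This reflection reduces negative parameters to positive ones.\<close>

lemma K_stat_uminus: "K_stat M a (\<lambda>\<omega>. - X \<omega>) = - K_stat M (- a) X"
  by (cases a) (auto simp: K_stat_def ess_min_def zero_ereal_def)

lemma K_stat_diff_const:
  assumes "X \<in> Linf M" shows "K_stat M a (\<lambda>\<omega>. X \<omega> - c) = K_stat M a X - c"
proof -
  have pinf: "K_stat M \<infinity> (\<lambda>\<omega>. Y \<omega> - d) = K_stat M \<infinity> Y - d" if "Y \<in> Linf M" for Y d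
    using ess_max_diff_const[OF that] by (simp add: K_stat_infty)
  show ?thesis
  proof (cases a)
    case (real r)
    have "mgf (\<lambda>\<omega>. X \<omega> - c) r = mgf X r * exp (- (r * c))"
      by (simp add: right_diff_distrib exp_diff exp_minus field_simps)
    then show ?thesis
      using real mgf_pos[OF assms, of r] integrable_Linf[OF assms] prob_space
      by (cases "r = 0") (auto simp: K_stat_real K_stat_0 ln_mult zero_ereal_def[symmetric] diff_divide_distrib)
  next
    case MInf
    then show ?thesis
      using pinf[OF Linf_uminus[OF assms], of "- c"] K_stat_uminus[of \<infinity> X]
        K_stat_uminus[of \<infinity> "\<lambda>\<omega>. X \<omega> - c"] by simp
  qed (simp add: pinf[OF assms])
qed

lemma ess_max_const [simp]: "ess_max M (\<lambda>_. c) = c"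
  unfolding ess_max_def by (subst esssup_const) (auto simp: emeasure_space_1)

lemma K_stat_const [simp]: "K_stat M a (\<lambda>_. c) = c"
  using prob_space by (cases a) (auto simp: K_stat_def ess_min_def)

section \<open>Monotonicity of K_a in the parameter a\<close>

lemma exp_tangent_le:
  fixes a b x :: real assumes "0 < a" "a \<le> b"
  shows "exp (a * x) \<le> 1 - a / b + a / b * exp (b * x)"
  using convex_onD[OF exp_convex, of "a / b" 0 "b * x"] assms
  by (simp add: field_simps)

text \<open>Recentring \<open>X\<close> at its a-statistic gives \<open>mgf Y a = 1\<close>. The
  chord bound \<open>exp_tangent_le\<close>, with \<open>a * x\<close> a convex combination of 0 and
  \<open>b * x\<close>, then integrates to \<open>1 \<le> mgf Y b\<close>.\<close>

lemma K_stat_mono_pos: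
  assumes X: "X \<in> Linf M" and ab: "0 < a" "a \<le> b"
  shows "K_stat M (ereal a) X \<le> K_stat M (ereal b) X"
proof -
  define Y where "Y \<omega> = X \<omega> - K_stat M (ereal a) X" for \<omega>
  have Y: "Y \<in> Linf M" and KY: "K_stat M c Y = K_stat M c X - K_stat M (ereal a) X" for c
    unfolding Y_def using X by (auto simp: Linf_diff_const K_stat_diff_const)
  have "1 = mgf Y a"
    using exp_K_stat[OF Y, of a] by (simp add: KY)
  also have "\<dots> \<le> expectation (\<lambda>\<omega>. 1 - a / b + a / b * exp (b * Y \<omega>))"
    using ab integrable_exp_Linf[OF Y]
    by (intro integral_mono exp_tangent_le Bochner_Integration.integrable_add
        integrable_mult_right) simp_all
  also have "\<dots> = 1 - a / b + a / b * mgf Y b"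
    using integrable_exp_Linf[OF Y, of b] by (simp add: prob_space)
  finally have "1 \<le> mgf Y b"
    using ab by (simp add: field_simps)
  then have "0 \<le> K_stat M (ereal b) Y"
    using ab by (simp add: K_stat_real)
  then show ?thesis by (simp add: KY)
qed

text \<open>For the centred variable, integrate \<open>1 + a * y \<le> exp (a * y)\<close>.\<close>

lemma K_stat_ge_expectation:
  assumes X: "X \<in> Linf M" and a: "0 < a"
  shows "expectation X \<le> K_stat M (ereal a) X"
proof -
  define Y where "Y \<omega> = X \<omega> - expectation X" for \<omega>
  have Y: "Y \<in> Linf M" and KY: "K_stat M c Y = K_stat M c X - expectation X" for c
    unfolding Y_def using X by (auto simp: Linf_diff_const K_stat_diff_const)
  have "1 = expectation (\<lambda>\<omega>. 1 + a * Y \<omega>)"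
    using integrable_Linf[OF Y] KY[of 0] by (simp add: prob_space K_stat_0)
  also have "\<dots> \<le> mgf Y a"
    using integrable_Linf[OF Y] integrable_exp_Linf[OF Y] by (intro integral_mono) simp_all
  finally have "0 \<le> K_stat M (ereal a) Y"
    using a by (simp add: K_stat_real)
  then show ?thesis by (simp add: KY)
qed

lemma K_stat_le_ess_max:
  assumes X: "X \<in> Linf M" and a: "0 \<le> a"
  shows "K_stat M (ereal a) X \<le> K_stat M \<infinity> X"
proof -
  let ?m = "ess_max M X"
  have AE: "AE \<omega> in M. X \<omega> \<le> ?m"
    using ess_max_le_iff[OF X] by blast
  show ?thesis
  proof (cases "a = 0")
    case True
    have "expectation X \<le> expectation (\<lambda>_. ?m)"
      using AE by (intro integral_mono_AE integrable_Linf X) auto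
    then show ?thesis
      using True by (simp add: K_stat_infty K_stat_0 prob_space zero_ereal_def[symmetric])
  next
    case False
    have "mgf X a \<le> expectation (\<lambda>_. exp (a * ?m))"
      using AE a by (intro integral_mono_AE integrable_exp_Linf X) (auto elim!: eventually_mono intro: mult_left_mono)
    then have "exp (a * K_stat M (ereal a) X) \<le> exp (a * ?m)"
      by (simp add: exp_K_stat[OF X] prob_space)
    then show ?thesis
      using a False by (simp add: K_stat_infty)
  qed
qed

lemma K_stat_mono_nonneg:
  assumes X: "X \<in> Linf M" and ab: "0 \<le> a" "a \<le> b"
  shows "K_stat M a X \<le> K_stat M b X"
proof (cases "b = \<infinity>")
  case True
  then show ?thesis
    using K_stat_le_ess_max[OF X] ab by (cases a) auto
next
  case False
  then obtain r s where rs: "a = ereal r" "b = ereal s"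
    using ab by (cases a; cases b) auto
  show ?thesis
  proof (cases "r = 0 \<or> s = 0")
    case True
    then have "r = 0" using ab rs by auto
    then show ?thesis
      using K_stat_ge_expectation[OF X, of s] ab rs
      by (cases "s = 0") (auto simp: K_stat_0 zero_ereal_def[symmetric])
  next
    case False
    then show ?thesis
      using K_stat_mono_pos[OF X, of r s] ab rs by auto
  qed
qed

text \<open>Negative parameters follow by reflection, and parameters of opposite sign are compared
  through the expectation at 0.\<close>

lemma K_stat_mono:
  assumes X: "X \<in> Linf M" and ab: "a \<le> b"
  shows "K_stat M a X \<le> K_stat M b X"
proof -
  have neg: "K_stat M c X \<le> K_stat M d X" if "c \<le> d" "d \<le> 0" for c d
  proof -
    have "K_stat M (- d) (\<lambda>\<omega>. - X \<omega>) \<le> K_stat M (- c) (\<lambda>\<omega>. - X \<omega>)"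
      using that by (intro K_stat_mono_nonneg Linf_uminus X) auto
    then show ?thesis by (simp add: K_stat_uminus)
  qed
  consider "0 \<le> a" | "b \<le> 0" | "a \<le> 0" "0 \<le> b"
    by (meson linear)
  then show ?thesis
  proof cases
    case 3
    then show ?thesis
      using neg[of a 0] K_stat_mono_nonneg[OF X, of 0 b] by simp
  qed (use neg K_stat_mono_nonneg X ab in auto)
qed

lemma K_stat_le_bound:
  assumes X: "X \<in> Linf M" and C: "\<And>\<omega>. \<omega> \<in> space M \<Longrightarrow> X \<omega> \<le> C"
  shows "K_stat M a X \<le> C"
proof -
  have "K_stat M a X \<le> ess_max M X"
    using K_stat_mono[OF X, of a \<infinity>] by (simp add: K_stat_infty)
  also have "\<dots> \<le> C"
    using C by (subst ess_max_le_iff[OF X]) auto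
  finally show ?thesis .
qed

lemma K_stat_ge_bound:
  assumes X: "X \<in> Linf M" and C: "\<And>\<omega>. \<omega> \<in> space M \<Longrightarrow> C \<le> X \<omega>"
  shows "C \<le> K_stat M a X"
  using K_stat_le_bound[OF Linf_uminus[OF X], of "- C" "- a"] C by (simp add: K_stat_uminus)

end

text \<open>Sublevel sets of a monotone function are down-closed, hence rays ending at their
  supremum. This makes K_a(X) measurable in a without any continuity argument.\<close>

lemma borel_measurable_mono_ereal:
  fixes f :: "ereal \<Rightarrow> real"
  assumes "mono f" shows "f \<in> borel_measurable borel"
proof (rule borel_measurableI_le)
  fix y
  define D where "D = {x. f x \<le> y}"
  have "{..<Sup D} \<subseteq> D"
  proof
    fix x assume "x \<in> {..<Sup D}"
    then obtain z where "z \<in> D" "x < z"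
      by (auto simp: less_Sup_iff)
    then show "x \<in> D"
      using monoD[OF assms less_imp_le[OF \<open>x < z\<close>]] by (simp add: D_def)
  qed
  moreover have "D \<subseteq> {..Sup D}"
    by (auto intro: Sup_upper)
  ultimately have "D = (if Sup D \<in> D then {..Sup D} else {..<Sup D})"
    by (auto simp: order.order_iff_strict)
  moreover have "(if Sup D \<in> D then {..Sup D} else {..<Sup D}) \<in> sets borel"
    by simp
  ultimately have "D \<in> sets borel"
    by (rule ssubst)
  then show "{x \<in> space borel. f x \<le> y} \<in> sets borel"
    by (simp add: D_def)
qed

section \<open>Mixtures\<close>

lemma is_mixtureD:
  assumes "is_mixture M l X Y Z" "B \<in> sets borel"
    and "X \<in> borel_measurable M" "Y \<in> borel_measurable M" "Z \<in> borel_measurable M"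
  shows "measure M (Z -` B \<inter> space M) =
    l * measure M (X -` B \<inter> space M) + (1 - l) * measure M (Y -` B \<inter> space M)"
  using assms by (simp add: is_mixture_def measure_distr)

lemma is_mixture_swap: "is_mixture M l X Y Z \<Longrightarrow> is_mixture M (1 - l) Y X Z"
  by (simp add: is_mixture_def)

lemma is_mixture_uminus:
  assumes "is_mixture M l X Y Z"
    and [measurable]: "X \<in> borel_measurable M" "Y \<in> borel_measurable M" "Z \<in> borel_measurable M"
  shows "is_mixture M l (\<lambda>\<omega>. - X \<omega>) (\<lambda>\<omega>. - Y \<omega>) (\<lambda>\<omega>. - Z \<omega>)"
  unfolding is_mixture_def
proof
  fix B :: "real set" assume B: "B \<in> sets borel"
  then have "uminus -` B \<in> sets borel"
    using measurable_sets[OF borel_measurable_uminus[OF measurable_ident_sets[OF refl]] B] by (simp add: id_def)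
  from is_mixtureD[OF assms(1) this] B
  show "measure (distr M borel (\<lambda>\<omega>. - Z \<omega>)) B = l * measure (distr M borel (\<lambda>\<omega>. - X \<omega>)) B
      + (1 - l) * measure (distr M borel (\<lambda>\<omega>. - Y \<omega>)) B"
    by (simp add: measure_distr vimage_comp comp_def)
qed

context prob_space
begin

text \<open>The definition of a mixture is the case of indicators; simple functions and monotone
  limits give the rest.\<close>

lemma is_mixture_nn_integral:
  fixes f :: "real \<Rightarrow> ennreal"
  assumes mix: "is_mixture M l X Y Z" and l: "0 \<le> l" "l \<le> 1"
    and [measurable]: "X \<in> borel_measurable M" "Y \<in> borel_measurable M" "Z \<in> borel_measurable M"
    and f: "f \<in> borel_measurable borel"
  shows "(\<integral>\<^sup>+\<omega>. f (Z \<omega>) \<partial>M) =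
    ennreal l * (\<integral>\<^sup>+\<omega>. f (X \<omega>) \<partial>M) + ennreal (1 - l) * (\<integral>\<^sup>+\<omega>. f (Y \<omega>) \<partial>M)"
  using f
proof (induction rule: borel_measurable_induct)
  case (cong f g)
  then show ?case by simp
next
  case (set A)
  have ind: "(\<integral>\<^sup>+\<omega>. indicator A (W \<omega>) \<partial>M) = ennreal (prob (W -` A \<inter> space M))"
    if [measurable]: "W \<in> borel_measurable M" for W :: "'a \<Rightarrow> real"
  proof -
    have "(\<integral>\<^sup>+\<omega>. indicator A (W \<omega>) \<partial>M) = (\<integral>\<^sup>+\<omega>. indicator (W -` A \<inter> space M) \<omega> \<partial>M)"
      by (intro nn_integral_cong) (auto simp: indicator_def)
    also have "\<dots> = emeasure M (W -` A \<inter> space M)"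
      by (intro nn_integral_indicator measurable_sets[OF that set])
    finally show ?thesis by (simp add: emeasure_eq_measure)
  qed
  show ?case
    using l is_mixtureD[OF mix set]
    by (simp add: ind ennreal_plus ennreal_mult)
next
  case (mult u v)
  note [measurable] = mult(2)
  show ?case
    using mult by (simp add: nn_integral_cmult distrib_left mult_ac)
next
  case (add u v)
  note [measurable] = add(1,3)
  show ?case
    using add by (simp add: nn_integral_add distrib_left add_ac)
next
  case (seq U)
  note [measurable] = seq(1)
  have lim: "(\<lambda>i. \<integral>\<^sup>+\<omega>. U i (W \<omega>) \<partial>M) \<longlonglongrightarrow> (\<integral>\<^sup>+\<omega>. (SUP i. U i) (W \<omega>) \<partial>M)"
    if [measurable]: "W \<in> borel_measurable M" for W :: "'a \<Rightarrow> real"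
    using seq(3) unfolding SUP_apply
    by (intro nn_integral_LIMSEQ LIMSEQ_SUP) (auto simp: incseq_def le_fun_def)
  have "(\<lambda>i. ennreal l * (\<integral>\<^sup>+\<omega>. U i (X \<omega>) \<partial>M) + ennreal (1 - l) * (\<integral>\<^sup>+\<omega>. U i (Y \<omega>) \<partial>M))
      \<longlonglongrightarrow> ennreal l * (\<integral>\<^sup>+\<omega>. (SUP i. U i) (X \<omega>) \<partial>M) + ennreal (1 - l) * (\<integral>\<^sup>+\<omega>. (SUP i. U i) (Y \<omega>) \<partial>M)"
    by (intro tendsto_add ennreal_tendsto_cmult lim) auto
  with lim[of Z] seq show ?case
    by (simp add: LIMSEQ_unique)
qed

text \<open>Integrability under the law of \<open>Z\<close> need not be known in advance: the
  nonnegative integral is computed first and is finite.\<close>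

lemma is_mixture_expectation_nonneg:
  fixes f :: "real \<Rightarrow> real"
  assumes mix: "is_mixture M l X Y Z" and l: "0 \<le> l" "l \<le> 1"
    and [measurable]: "X \<in> borel_measurable M" "Y \<in> borel_measurable M" "Z \<in> borel_measurable M"
    and f [measurable]: "f \<in> borel_measurable borel" and nonneg: "\<And>x. 0 \<le> f x"
    and int: "integrable M (\<lambda>\<omega>. f (X \<omega>))" "integrable M (\<lambda>\<omega>. f (Y \<omega>))"
  shows "expectation (\<lambda>\<omega>. f (Z \<omega>)) =
    l * expectation (\<lambda>\<omega>. f (X \<omega>)) + (1 - l) * expectation (\<lambda>\<omega>. f (Y \<omega>))"
proof -
  let ?r = "l * expectation (\<lambda>\<omega>. f (X \<omega>)) + (1 - l) * expectation (\<lambda>\<omega>. f (Y \<omega>))"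
  have r: "0 \<le> ?r"
    using l nonneg by (simp add: integral_nonneg_AE)
  have "(\<integral>\<^sup>+\<omega>. f (Z \<omega>) \<partial>M) = ennreal ?r"
    using is_mixture_nn_integral[OF mix l, of "\<lambda>x. ennreal (f x)"] l nonneg
    by (simp add: nn_integral_eq_integral[OF int(1)] nn_integral_eq_integral[OF int(2)]
      ennreal_mult ennreal_plus integral_nonneg_AE)
  then show ?thesis
    using r nonneg by (simp add: integral_eq_nn_integral)
qed

context
  fixes l X Y Z
  assumes mix: "is_mixture M l X Y Z" and l: "0 < l" "l < 1"
    and X: "X \<in> Linf M" and Y: "Y \<in> Linf M" and Z: "Z \<in> Linf M"
begin

lemma is_mixture_mgf: "mgf Z a = l * mgf X a + (1 - l) * mgf Y a"
  using l by (intro is_mixture_expectation_nonneg[OF mix])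
    (auto intro: Linf_measurable X Y Z integrable_exp_Linf)

lemma is_mixture_expectation: "expectation Z = l * expectation X + (1 - l) * expectation Y"
proof -
  \<comment> \<open>The identity is available for nonnegative functions only, so it is applied to
    the positive part (\<open>s = 1\<close>) and the negative part (\<open>s = - 1\<close>).\<close>
  have int: "integrable M (\<lambda>\<omega>. max 0 (s * W \<omega>))" if "W \<in> Linf M" for s W
    by (intro integrable_max integrable_mult_right integrable_Linf that integrable_const)
  have parts: "expectation (\<lambda>\<omega>. max 0 (s * Z \<omega>)) =
      l * expectation (\<lambda>\<omega>. max 0 (s * X \<omega>)) + (1 - l) * expectation (\<lambda>\<omega>. max 0 (s * Y \<omega>))" for s
    using l by (intro is_mixture_expectation_nonneg[OF mix, where f = "\<lambda>x. max 0 (s * x)"])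
      (auto intro: Linf_measurable X Y Z int)
  have split: "expectation W = expectation (\<lambda>\<omega>. max 0 (1 * W \<omega>)) - expectation (\<lambda>\<omega>. max 0 (- 1 * W \<omega>))"
    if W: "W \<in> Linf M" for W
  proof -
    have "expectation W = expectation (\<lambda>\<omega>. max 0 (1 * W \<omega>) - max 0 (- 1 * W \<omega>))"
      by (rule Bochner_Integration.integral_cong) auto
    also have "\<dots> = expectation (\<lambda>\<omega>. max 0 (1 * W \<omega>)) - expectation (\<lambda>\<omega>. max 0 (- 1 * W \<omega>))"
      by (intro Bochner_Integration.integral_diff int W)
    finally show ?thesis .
  qed
  show ?thesis
    unfolding split[OF X] split[OF Y] split[OF Z] parts by (simp only: algebra_simps)
qed

text \<open>The mass of \<open>Z\<close> above \<open>t\<close> is a combination of the two masses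
  with positive weights, so it vanishes exactly when both do.\<close>

lemma is_mixture_ess_max: "ess_max M Z = max (ess_max M X) (ess_max M Y)"
proof -
  have AE: "ess_max M W \<le> t \<longleftrightarrow> prob (W -` {t<..} \<inter> space M) = 0" if W: "W \<in> Linf M" for W t
  proof -
    note [measurable] = Linf_measurable[OF W]
    have "ess_max M W \<le> t \<longleftrightarrow> emeasure M {\<omega> \<in> space M. \<not> W \<omega> \<le> t} = 0"
      unfolding ess_max_le_iff[OF W] by (subst AE_iff_measurable[OF _ refl]) auto
    also have "{\<omega> \<in> space M. \<not> W \<omega> \<le> t} = W -` {t<..} \<inter> space M" by auto
    finally show ?thesis by (simp add: emeasure_eq_measure)
  qed
  have "ess_max M Z \<le> t \<longleftrightarrow> max (ess_max M X) (ess_max M Y) \<le> t" for t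
    using l is_mixtureD[OF mix, of "{t<..}"] X Y Z
    by (simp add: AE Linf_measurable add_nonneg_eq_0_iff)
  then show ?thesis
    by (meson antisym order_refl)
qed

end

text \<open>The constant 0 has moment generating function 1, which contributes the summand
  \<open>1 - l\<close>. The case of minus infinity is the reflected essential maximum.\<close>

lemma is_mixture_K_stat_0:
  assumes "is_mixture M l X (\<lambda>_. 0) Z" "0 < l" "l < 1" "X \<in> Linf M" "Z \<in> Linf M"
  shows "a \<noteq> 0 \<Longrightarrow> K_stat M (ereal a) Z = ln (1 - l + l * exp (a * K_stat M (ereal a) X)) / a"
    and "K_stat M 0 Z = l * K_stat M 0 X"
    and "K_stat M \<infinity> Z = max (K_stat M \<infinity> X) 0"
    and "K_stat M (- \<infinity>) Z = min (K_stat M (- \<infinity>) X) 0"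
proof -
  note mix = assms(1-4) Linf_const assms(5)
  show "a \<noteq> 0 \<Longrightarrow> K_stat M (ereal a) Z = ln (1 - l + l * exp (a * K_stat M (ereal a) X)) / a"
    using is_mixture_mgf[OF mix, of a] assms by (simp add: K_stat_real exp_K_stat mgf_pos prob_space add.commute)
  show "K_stat M 0 Z = l * K_stat M 0 X"
    using is_mixture_expectation[OF mix] by (simp add: K_stat_0)
  show max: "K_stat M \<infinity> Z = max (K_stat M \<infinity> X) 0"
    using is_mixture_ess_max[OF mix] by (simp add: K_stat_infty)
  have "is_mixture M l (\<lambda>\<omega>. - X \<omega>) (\<lambda>_. 0) (\<lambda>\<omega>. - Z \<omega>)"
    using is_mixture_uminus[OF assms(1)] assms by (simp add: Linf_measurable)
  from is_mixture_ess_max[OF this assms(2,3) Linf_uminus Linf_const Linf_uminus] assms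
  have "- K_stat M (- \<infinity>) Z = max (- K_stat M (- \<infinity>) X) 0"
    by (simp add: K_stat_infty[symmetric] K_stat_uminus)
  then show "K_stat M (- \<infinity>) Z = min (K_stat M (- \<infinity>) X) 0"
    by arith
qed

end

section \<open>Nonatomic spaces and two-valued variables\<close>

context prob_space
begin

text \<open>Halving: of a proper piece of \<open>B\<close> and its complement in \<open>B\<close>,
  one has at most half the measure of \<open>B\<close>, and both have positive measure.\<close>

lemma nonatomic_small_subset:
  assumes "nonatomic M" "A \<in> sets M" "0 < prob A" "0 < e"
  obtains B where "B \<in> sets M" "B \<subseteq> A" "0 < prob B" "prob B \<le> e"
proof -
  have "\<exists>B\<in>sets M. B \<subseteq> A \<and> 0 < prob B \<and> prob B \<le> (1/2) ^ n" for n
  proof (induction n)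
    case 0
    then show ?case using assms by (auto intro!: bexI[of _ A])
  next
    case (Suc n)
    then obtain B where B: "B \<in> sets M" "B \<subseteq> A" "0 < prob B" "prob B \<le> (1/2) ^ n"
      by blast
    then obtain C where C: "C \<in> sets M" "C \<subseteq> B" "0 < prob C" "prob C < prob B"
      using assms(1) unfolding nonatomic_def by blast
    have D: "prob (B - C) = prob B - prob C"
      using B C by (intro finite_measure_Diff) auto
    show ?case
    proof (cases "prob C \<le> prob B / 2")
      case True
      then show ?thesis using B C by (intro bexI[of _ C]) auto
    next
      case False
      then show ?thesis using B C D by (intro bexI[of _ "B - C"]) auto
    qed
  qed
  moreover obtain n where "(1/2) ^ n < e"
    using real_arch_pow_inv[OF \<open>0 < e\<close>, of "1/2"] by auto
  ultimately show thesis
    using that by (meson less_imp_le order_trans)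
qed

text \<open>Sierpinski's theorem, by exhaustion: greedily add a piece of at least half the largest
  admissible measure.\<close>

lemma nonatomic_subset_prob:
  assumes na: "nonatomic M" and A: "A \<in> sets M" and p: "0 \<le> p" "p \<le> prob A"
  obtains B where "B \<in> sets M" "B \<subseteq> A" "prob B = p"
proof -
  define adm where "adm B = {C \<in> sets M. C \<subseteq> A - B \<and> prob B + prob C \<le> p}" for B
  define P where "P B \<longleftrightarrow> B \<in> sets M \<and> B \<subseteq> A \<and> prob B \<le> p" for B
  \<comment> \<open>The supremum \<open>s\<close> of admissible measures need not be attained, but
    if positive it is at most twice the measure of some admissible set; this is the source of the
    factor 2.\<close>
  have step: "\<exists>C\<in>adm B. \<forall>D\<in>adm B. prob D \<le> 2 * prob C" if B: "P B" for B
  proof -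
    have ne: "{} \<in> adm B" using B by (auto simp: adm_def P_def)
    have bdd: "bdd_above (prob ` adm B)"
      by (intro bdd_aboveI[of _ 1]) auto
    define s where "s = Sup (prob ` adm B)"
    have le: "prob D \<le> s" if "D \<in> adm B" for D
      unfolding s_def using that bdd by (intro cSup_upper) auto
    have "0 \<le> s" using le[OF ne] by simp
    show ?thesis
    proof (cases "s = 0")
      case True
      then show ?thesis using le ne by (intro bexI[of _ "{}"]) auto
    next
      case False
      then have "s / 2 < Sup (prob ` adm B)"
        using \<open>0 \<le> s\<close> by (simp add: s_def)
      moreover have "prob ` adm B \<noteq> {}"
        using ne by blast
      ultimately obtain C where "C \<in> adm B" "s / 2 < prob C"
        using less_cSup_iff[OF _ bdd] by blast
      then show ?thesis using le by (intro bexI[of _ C]) force+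
    qed
  qed
  define Q where "Q B B' \<longleftrightarrow> B \<subseteq> B' \<and> (\<forall>D\<in>adm B. prob D \<le> 2 * (prob B' - prob B))" for B B'
  have "\<exists>B'. P B' \<and> Q B B'" if B: "P B" for B
  proof -
    obtain C where C: "C \<in> adm B" "\<forall>D\<in>adm B. prob D \<le> 2 * prob C"
      using step[OF B] by blast
    have "prob (B \<union> C) = prob B + prob C"
      using B C by (intro finite_measure_Union) (auto simp: adm_def P_def)
    then show ?thesis
      using B C by (intro exI[of _ "B \<union> C"]) (auto simp: adm_def P_def Q_def)
  qed
  moreover have "P {}" using p by (simp add: P_def)
  ultimately obtain F where F: "\<And>n. P (F n)" "\<And>n. Q (F n) (F (Suc n))"
    using dependent_nat_choice[of "\<lambda>_. P" "\<lambda>_. Q"] by metis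
  define B where "B = (\<Union>n. F n)"
  have inc: "incseq F" using F(2) by (intro incseq_SucI) (auto simp: Q_def)
  have B: "B \<in> sets M" "B \<subseteq> A" using F(1) by (auto simp: B_def P_def)
  have lim: "(\<lambda>n. prob (F n)) \<longlonglongrightarrow> prob B"
    unfolding B_def using F(1) by (intro finite_Lim_measure_incseq inc) (auto simp: P_def)
  have "prob B \<le> p"
    using lim F(1) by (intro LIMSEQ_le_const2[OF lim]) (auto simp: P_def)
  moreover have "\<not> prob B < p"
  proof
    assume less: "prob B < p"
    have "prob (A - B) = prob A - prob B"
      using A B by (intro finite_measure_Diff) auto
    then have "0 < prob (A - B)" using less p by simp
    then obtain D where D: "D \<in> sets M" "D \<subseteq> A - B" "0 < prob D" "prob D \<le> p - prob B"
      using nonatomic_small_subset[OF na, of "A - B" "p - prob B"] A B less by auto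
    \<comment> \<open>A set \<open>D\<close> that still fits at the end was admissible at every
      stage, so it is bounded by twice each increment, and the increments tend to 0.\<close>
    have "prob D \<le> 2 * (prob (F (Suc n)) - prob (F n))" for n
    proof -
      have "prob (F n) \<le> prob B"
        using B by (intro finite_measure_mono) (auto simp: B_def)
      then have "D \<in> adm (F n)"
        using D by (auto simp: adm_def B_def)
      then show ?thesis using F(2)[of n] by (simp add: Q_def)
    qed
    moreover have "(\<lambda>n. 2 * (prob (F (Suc n)) - prob (F n))) \<longlonglongrightarrow> 2 * (prob B - prob B)"
      by (intro tendsto_intros LIMSEQ_Suc[OF lim] lim)
    ultimately have "prob D \<le> 2 * (prob B - prob B)"
      by (intro LIMSEQ_le_const) auto
    then show False using D by simp
  qed
  ultimately show thesis using B that by force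
qed

section \<open>Two-valued variables and their mixtures with 0\<close>

definition two_valued :: "'a set \<Rightarrow> real \<Rightarrow> real \<Rightarrow> 'a \<Rightarrow> real" where
  "two_valued A x y \<omega> = (if \<omega> \<in> A then x else y)"

context
  fixes A assumes A [measurable]: "A \<in> sets M"
begin

lemma Linf_two_valued: "two_valued A x y \<in> Linf M"
  unfolding two_valued_def by (rule LinfI[where C = "max \<bar>x\<bar> \<bar>y\<bar>"]) auto

lemma expectation_two_valued:
  fixes f :: "real \<Rightarrow> real"
  shows "expectation (\<lambda>\<omega>. f (two_valued A x y \<omega>)) = prob A * f x + (1 - prob A) * f y"
proof -
  have "expectation (\<lambda>\<omega>. f (two_valued A x y \<omega>)) = expectation (\<lambda>\<omega>. f y + (f x - f y) * indicator A \<omega>)"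
    by (rule Bochner_Integration.integral_cong) (auto simp: two_valued_def)
  also have "\<dots> = f y + (f x - f y) * prob A"
    using A by (subst Bochner_Integration.integral_add) (auto simp: prob_space less_top[symmetric])
  finally show ?thesis by (simp add: algebra_simps)
qed

lemma mgf_two_valued: "mgf (two_valued A x y) a = prob A * exp (a * x) + (1 - prob A) * exp (a * y)"
  using expectation_two_valued[of "\<lambda>t. exp (a * t)"] .

lemma ess_max_two_valued:
  assumes "0 < prob A" "prob A < 1"
  shows "ess_max M (two_valued A x y) = max x y"
proof -
  have not: "\<not> (AE \<omega> in M. \<omega> \<notin> A)" "\<not> (AE \<omega> in M. \<omega> \<in> A)"
    using assms A prob_eq_0[OF A] prob_eq_1[OF A] by auto
  have "ess_max M (two_valued A x y) \<le> t \<longleftrightarrow> max x y \<le> t" for t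
  proof
    assume "ess_max M (two_valued A x y) \<le> t"
    then have AE: "AE \<omega> in M. two_valued A x y \<omega> \<le> t"
      by (simp add: ess_max_le_iff Linf_two_valued)
    have "AE \<omega> in M. \<omega> \<notin> A" if "\<not> x \<le> t"
      using AE that by (auto elim!: eventually_mono simp: two_valued_def)
    moreover have "AE \<omega> in M. \<omega> \<in> A" if "\<not> y \<le> t"
      using AE that by (auto elim!: eventually_mono simp: two_valued_def split: if_splits)
    ultimately show "max x y \<le> t"
      using not by auto
  next
    assume "max x y \<le> t"
    then show "ess_max M (two_valued A x y) \<le> t"
      by (auto simp: ess_max_le_iff Linf_two_valued two_valued_def)
  qed
  then show ?thesis by (meson antisym order_refl)
qed

text \<open>Choosing a fraction \<open>l\<close> of \<open>A\<close> and of its complement yields an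
  event \<open>E\<close> of probability \<open>l\<close> independent of the variable. Keeping the
  variable on \<open>E\<close> and setting it to 0 off \<open>E\<close> realises the
  mixture.\<close>

lemma mixture_two_valued_exists:
  assumes na: "nonatomic M" and l: "0 \<le> l" "l \<le> 1"
  obtains Z where "Z \<in> Linf M" "is_mixture M l (two_valued A x y) (\<lambda>_. 0) Z"
proof -
  let ?X = "two_valued A x y"
  have le: "l * prob C \<le> prob C" for C
    using l by (simp add: mult_left_le_one_le)
  obtain A1 where A1 [measurable]: "A1 \<in> sets M" and A1': "A1 \<subseteq> A" "prob A1 = l * prob A"
    using nonatomic_subset_prob[OF na A, of "l * prob A"] l le by auto
  obtain A2 where A2 [measurable]: "A2 \<in> sets M" and A2': "A2 \<subseteq> space M - A" "prob A2 = l * prob (space M - A)"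
    using nonatomic_subset_prob[OF na, of "space M - A" "l * prob (space M - A)"] l le A by auto
  define E where "E = A1 \<union> A2"
  define Z where "Z \<omega> = (if \<omega> \<in> E then ?X \<omega> else 0)" for \<omega>
  have [measurable]: "E \<in> sets M" by (simp add: E_def)
  have X: "?X \<in> borel_measurable M"
    by (intro Linf_measurable Linf_two_valued)
  have Z: "Z \<in> Linf M"
    unfolding Z_def using X by (intro LinfI[where C = "max \<bar>x\<bar> \<bar>y\<bar>"]) (auto simp: two_valued_def)
  have probE: "prob (?X -` B \<inter> E) = l * prob (?X -` B \<inter> space M)" for B
  proof -
    define c1 c2 :: real where "c1 = of_bool (x \<in> B)" and "c2 = of_bool (y \<in> B)"
    have *: "prob (?X -` B \<inter> (C \<union> D)) = c1 * prob C + c2 * prob D"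
      if "C \<in> sets M" "D \<in> sets M" "C \<subseteq> A" "D \<subseteq> space M - A" for C D
    proof -
      have eq: "?X -` B \<inter> (C \<union> D) = (if x \<in> B then C else {}) \<union> (if y \<in> B then D else {})"
        using that by (auto simp: two_valued_def)
      show ?thesis
        unfolding eq using that by (subst finite_measure_Union) (auto simp: c1_def c2_def)
    qed
    have "space M = A \<union> (space M - A)" using sets.sets_into_space[OF A] by auto
    then have "prob (?X -` B \<inter> space M) = c1 * prob A + c2 * prob (space M - A)"
      using *[of A "space M - A"] A by auto
    then show ?thesis
      using *[OF A1 A2 A1'(1) A2'(1)] A1' A2' by (simp add: E_def algebra_simps)
  qed
  have "is_mixture M l ?X (\<lambda>_. 0) Z"
    unfolding is_mixture_def
  proof
    fix B :: "real set" assume B: "B \<in> sets borel"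
    have pE: "prob E = l"
      using probE[of UNIV] sets.sets_into_space[of E M] by (simp add: prob_space)
    have eq: "Z -` B \<inter> space M = (?X -` B \<inter> E) \<union> (if 0 \<in> B then space M - E else {})"
      using sets.sets_into_space[of E M] by (auto simp: Z_def split: if_splits)
    have "?X -` B \<inter> E = (?X -` B \<inter> space M) \<inter> E"
      using sets.sets_into_space[of E M] by auto
    then have "?X -` B \<inter> E \<in> sets M"
      using measurable_sets[OF X B] by simp
    then have "prob (Z -` B \<inter> space M) = l * prob (?X -` B \<inter> space M) + (1 - l) * of_bool (0 \<in> B)"
      unfolding eq by (subst finite_measure_Union) (auto simp: probE prob_compl pE)
    then show "measure (distr M borel Z) B = l * measure (distr M borel ?X) B
        + (1 - l) * measure (distr M borel (\<lambda>_. 0)) B"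
      using B X Linf_measurable[OF Z] by (simp add: measure_distr measure_return indicator_def)
  qed
  with Z show thesis by (rule that)
qed

end
end

section \<open>Betweenness excludes spread-out measures\<close>

text \<open>Betweenness in terms of values of the functional, so that it can be transferred to
  reflected functionals without a preference.\<close>

definition betweenness_functional :: "'a measure \<Rightarrow> (('a \<Rightarrow> real) \<Rightarrow> real) \<Rightarrow> bool" where
  "betweenness_functional M \<Phi> \<longleftrightarrow>
     (\<forall>X\<in>Linf M. \<forall>Y\<in>Linf M. \<forall>l\<in>{0<..<1}. \<forall>Z\<in>Linf M. is_mixture M l X Y Z \<longrightarrow>
        (\<Phi> X = \<Phi> Y \<longleftrightarrow> \<Phi> Z = \<Phi> Y))"

lemma betweenness_functionalD:
  assumes "betweenness_functional M \<Phi>" "is_mixture M l X Y Z" "0 < l" "l < 1"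
    "X \<in> Linf M" "Y \<in> Linf M" "Z \<in> Linf M"
  shows "\<Phi> X = \<Phi> Y \<longleftrightarrow> \<Phi> Z = \<Phi> Y"
  using assms unfolding betweenness_functional_def by (meson greaterThanLessThan_iff)

lemma betweenness_iff_functional:
  assumes "represented_by M pref \<Phi>"
  shows "betweenness M pref \<longleftrightarrow> betweenness_functional M \<Phi>"
proof -
  have "indifferent pref X Y \<longleftrightarrow> \<Phi> X = \<Phi> Y" if "X \<in> Linf M" "Y \<in> Linf M" for X Y
    using assms that by (auto simp: represented_by_def indifferent_def)
  then show ?thesis
    unfolding betweenness_def betweenness_functional_def by simp
qed

lemma betweenness_functional_cong:
  assumes "\<And>X. X \<in> Linf M \<Longrightarrow> \<Phi> X = \<Psi> X"
  shows "betweenness_functional M \<Phi> \<longleftrightarrow> betweenness_functional M \<Psi>"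
  using assms unfolding betweenness_functional_def by simp

context prob_space
begin

lemma betweenness_functional_reflect:
  assumes "betweenness_functional M \<Phi>"
  shows "betweenness_functional M (\<lambda>X. - \<Phi> (\<lambda>\<omega>. - X \<omega>))"
  unfolding betweenness_functional_def neg_equal_iff_equal
  by (intro ballI impI betweenness_functionalD[OF assms] is_mixture_uminus)
    (auto intro: Linf_measurable Linf_uminus)

text \<open>For \<open>a \<noteq> 0\<close>, equality of the values at \<open>X\<close> and
  \<open>Y\<close> amounts to \<open>P X * Q Y - P Y * Q X = 0\<close> for two moment generating
  functions \<open>P\<close> and \<open>Q\<close>. The left side is linear in the law of
  \<open>X\<close> and vanishes at \<open>X = Y\<close>, so mixing with \<open>Y\<close> only
  multiplies it by \<open>l\<close>.\<close>

lemma K_stat_pair_betweenness: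
  assumes "0 \<le> a"
  shows "betweenness_functional M
    (\<lambda>X. \<beta> * K_stat M (ereal (- a * \<beta>)) X + (1 - \<beta>) * K_stat M (ereal (a * (1 - \<beta>))) X)"
    (is "betweenness_functional M ?\<Phi>")
  unfolding betweenness_functional_def
proof (intro ballI impI)
  fix X Y l Z
  assume X: "X \<in> Linf M" and Y: "Y \<in> Linf M" and "l \<in> {0<..<1}" and Z: "Z \<in> Linf M"
    and mix: "is_mixture M l X Y Z"
  then have l: "0 < l" "l < 1" by auto
  note mixs = mix l X Y Z
  show "?\<Phi> X = ?\<Phi> Y \<longleftrightarrow> ?\<Phi> Z = ?\<Phi> Y"
  proof (cases "a = 0")
    case True
    have "?\<Phi> W = expectation W" for W
      using True by (simp add: K_stat_0 zero_ereal_def[symmetric] algebra_simps)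
    moreover have "expectation Z - expectation Y = l * (expectation X - expectation Y)"
      using is_mixture_expectation[OF mixs] by (simp add: algebra_simps)
    ultimately show ?thesis
      using l by (metis eq_iff_diff_eq_0 less_irrefl mult_eq_0_iff)
  next
    case False
    define P where "P W = mgf W (a * (1 - \<beta>))" for W
    define Q where "Q W = mgf W (- a * \<beta>)" for W
    have pos: "0 < P W" "0 < Q W" if "W \<in> Linf M" for W
      unfolding P_def Q_def using that by (rule mgf_pos)+
    \<comment> \<open>Both sides vanish at \<open>r = 0\<close>, so zero parameters, as for \<beta>
      equal to 0 or 1, need no separate treatment.\<close>
    have aK: "r * K_stat M (ereal r) W = ln (mgf W r)" for W r
      using prob_space by (cases "r = 0") (simp_all add: K_stat_real)
    have "a * ?\<Phi> W = (a * (1 - \<beta>)) * K_stat M (ereal (a * (1 - \<beta>))) W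
        - (- a * \<beta>) * K_stat M (ereal (- a * \<beta>)) W" for W
      \<comment> \<open>Multiplied by \<open>a\<close>, the weights become the parameters
        themselves, up to the sign of the first.\<close>
      by (simp add: algebra_simps)
    then have "a * ?\<Phi> W = ln (P W) - ln (Q W)" for W
      by (simp only: aK P_def Q_def)
    then have Phi: "a * ?\<Phi> W = ln (P W / Q W)" if "W \<in> Linf M" for W
      using pos[OF that] by (simp add: ln_div)
    have iff: "?\<Phi> V = ?\<Phi> W \<longleftrightarrow> P V * Q W - P W * Q V = 0" if "V \<in> Linf M" "W \<in> Linf M" for V W
    proof -
      have "?\<Phi> V = ?\<Phi> W \<longleftrightarrow> a * ?\<Phi> V = a * ?\<Phi> W"
        using False by (simp only: mult_cancel_left) simp
      also have "\<dots> \<longleftrightarrow> P V / Q V = P W / Q W"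
        unfolding Phi[OF that(1)] Phi[OF that(2)] using pos that by (intro ln_inj_iff) auto
      also have "\<dots> \<longleftrightarrow> P V * Q W - P W * Q V = 0"
        using pos(2)[OF that(1)] pos(2)[OF that(2)] by (simp add: frac_eq_eq)
      finally show ?thesis .
    qed
    have "P Z * Q Y - P Y * Q Z = l * (P X * Q Y - P Y * Q X)"
      unfolding P_def Q_def is_mixture_mgf[OF mixs] by (simp add: algebra_simps)
    then show ?thesis
      unfolding iff[OF X Y] iff[OF Z Y] using l by simp
  qed
qed

end

text \<open>A locale, so that every result on the nonnegative half-line can be instantiated again at
  the reflected measure.\<close>

locale betweenness_K_integral = prob_space M + mu: prob_space \<mu>
  for M :: "'a measure" and \<mu> :: "ereal measure" +
  assumes nonatomic: "nonatomic M"
    and sets_mu: "sets \<mu> = sets borel"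
    and between: "betweenness_functional M (\<lambda>X. \<integral>a. K_stat M a X \<partial>\<mu>)"
begin

definition \<Phi> :: "('a \<Rightarrow> real) \<Rightarrow> real" where
  "\<Phi> X = (\<integral>a. K_stat M a X \<partial>\<mu>)"

lemma Phi_between: "betweenness_functional M \<Phi>"
  using between by (simp add: \<Phi>_def[abs_def])

lemmas [measurable_cong] = sets_mu

lemma K_stat_measurable_mu: "X \<in> Linf M \<Longrightarrow> (\<lambda>a. K_stat M a X) \<in> borel_measurable \<mu>"
  unfolding measurable_cong_sets[OF sets_mu refl]
  by (intro borel_measurable_mono_ereal monoI K_stat_mono)

lemma K_stat_integrable_mu:
  assumes X: "X \<in> Linf M" shows "integrable \<mu> (\<lambda>a. K_stat M a X)"
proof -
  obtain C where "\<And>\<omega>. \<omega> \<in> space M \<Longrightarrow> \<bar>X \<omega>\<bar> \<le> C"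
    using Linf_boundE[OF X] by blast
  then have "\<bar>K_stat M a X\<bar> \<le> C" for a
    using K_stat_le_bound[OF X, of C a] K_stat_ge_bound[OF X, of "- C" a] by (force simp: abs_le_iff)
  then show ?thesis
    by (intro mu.integrable_const_bound[where B = C] K_stat_measurable_mu X) simp
qed

lemma Phi_diff_const: "X \<in> Linf M \<Longrightarrow> \<Phi> (\<lambda>\<omega>. X \<omega> - c) = \<Phi> X - c"
  by (simp add: \<Phi>_def K_stat_diff_const K_stat_integrable_mu mu.prob_space)

lemma Phi_0: "\<Phi> (\<lambda>_. 0) = 0"
  by (simp add: \<Phi>_def)

lemma Phi_mixture_0:
  assumes "is_mixture M l X (\<lambda>_. 0) Z" "0 < l" "l < 1" "X \<in> Linf M" "Z \<in> Linf M" "\<Phi> X = 0"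
  shows "\<Phi> Z = 0"
  using betweenness_functionalD[OF Phi_between assms(1-4) Linf_const assms(5)] assms(6)
  by (simp add: Phi_0)

text \<open>The test variable is \<open>n * t\<close> with the exponentially small probability \<open>exp (- n)\<close>, and \<open>0\<close>
  otherwise, where \<open>1 / a2 < t < 1 / a1\<close>: for large \<open>n\<close> its statistics are bounded for
  \<open>a \<le> a1\<close> and grow linearly for \<open>a \<ge> a2\<close>. Hence, after recentring at its \<open>\<Phi>\<close>-value, the former
  are very negative, and mixing with \<open>0\<close> raises them far more than it lowers the latter.\<close>

lemma no_mass_gap:
  assumes a1: "0 < a1" and a12: "a1 < a2"
  shows "measure \<mu> {0..ereal a1} = 0 \<or> measure \<mu> {ereal a2..} = 0"
proof (rule ccontr)
  assume "\<not> ?thesis"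
  then have p1: "0 < measure \<mu> {0..ereal a1}" and d: "0 < measure \<mu> {ereal a2..}"
    by (auto simp: zero_less_measure_iff)
  let ?p1 = "measure \<mu> {0..ereal a1}" and ?d = "measure \<mu> {ereal a2..}"
  \<comment> \<open>The midpoint of \<open>1 / a2\<close> and \<open>1 / a1\<close>.\<close>
  define t where "t = (1 / a1 + 1 / a2) / 2"
  have t: "0 < t" "a1 * t < 1" "1 / a2 < t"
    using a1 a12 by (auto simp: t_def field_simps)
  \<comment> \<open>The growth rate of the \<Phi>-value: \<open>n * e \<le> \<Phi> W\<close> is
    shown below.\<close>
  define e where "e = ?d * (t - 1 / a2)"
  have e: "0 < e" using d t by (simp add: e_def)
  \<comment> \<open>Small enough that the mean of the mixture is at least
    \<open>- (n * e / 4)\<close>.\<close>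
  define l where "l = min (1 / 2) (e / (4 * t))"
  have l: "0 < l" "l < 1" "l * t \<le> e / 4"
    using e t by (auto simp: l_def min_def field_simps)
  have lnl: "ln l < 0" using l by simp
  \<comment> \<open>The two quotients make \<open>n * e / 2\<close> exceed the bound on the
    a1-statistic of \<open>W\<close>, and the total gain from mixing exceed the largest possible
    loss \<open>- ln l / a1\<close>.\<close>
  define n where "n = 1 + (ln 2 / a1) / (e / 2) + (- ln l / a1) / (?p1 * e / 4)"
  have pos: "0 \<le> (ln 2 / a1) / (e / 2)" "0 \<le> (- ln l / a1) / (?p1 * e / 4)"
    by (intro divide_nonneg_nonneg mult_nonneg_nonneg; use a1 e p1 lnl in simp)+
  have n0: "0 < n" using pos by (simp add: n_def)
  have "(ln 2 / a1) / (e / 2) < n" "(- ln l / a1) / (?p1 * e / 4) < n"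
    using pos by (auto simp: n_def)
  then have n1: "ln 2 / a1 < n * (e / 2)" and n2: "- ln l / a1 < n * (?p1 * e / 4)"
    using e p1 by (simp_all only: pos_divide_less_eq mult_pos_pos half_gt_zero zero_less_divide_iff zero_less_numeral simp_thms)
  obtain A where A: "A \<in> sets M" "prob A = exp (- n)"
    using nonatomic_subset_prob[OF nonatomic, of "space M" "exp (- n)"] n0 by (auto simp: prob_space)
  define W where "W = two_valued A (n * t) 0"
  have W: "W \<in> Linf M" by (simp add: W_def Linf_two_valued A)
  have KW0: "0 \<le> K_stat M a W" and KW1: "K_stat M a W \<le> n * t" for a
    using n0 t by (auto intro!: K_stat_ge_bound K_stat_le_bound W) (auto simp: W_def two_valued_def)
  \<comment> \<open>Already the contribution of the event \<open>A\<close> to the moment generating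
    function suffices.\<close>
  have K2: "n * (t - 1 / a2) \<le> K_stat M (ereal a2) W"
  proof -
    have "exp (a2 * (n * (t - 1 / a2))) = exp (- n) * exp (a2 * (n * t))"
      using a1 a12 by (simp add: exp_add[symmetric] field_simps)
    also have "\<dots> \<le> mgf W a2"
      using n0 by (simp add: W_def mgf_two_valued A)
    also have "\<dots> = exp (a2 * K_stat M (ereal a2) W)"
      by (rule exp_K_stat[OF W, symmetric])
    finally show ?thesis using a1 a12 by simp
  qed
  have K1: "K_stat M (ereal a1) W \<le> ln 2 / a1"
  proof -
    have "n * (a1 * t - 1) \<le> 0"
      using n0 t by (intro mult_nonneg_nonpos) auto
    then have "exp (- n) * exp (a1 * (n * t)) \<le> 1"
      by (simp add: exp_add[symmetric] algebra_simps)
    then have "exp (- n) * exp (a1 * (n * t)) + (1 - exp (- n)) * exp (a1 * 0) \<le> 1 + 1"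
      by (intro add_mono) auto
    then have "mgf W a1 \<le> 2"
      by (simp only: W_def mgf_two_valued A one_add_one)
    then show ?thesis
      using a1 mgf_pos[OF W, of a1] by (simp add: K_stat_real divide_right_mono)
  qed
  define c where "c = \<Phi> W"
  have c_ge: "n * e \<le> c"
  proof -
    have "n * e = (\<integral>a. n * (t - 1 / a2) * indicator {ereal a2..} a \<partial>\<mu>)"
      by (simp add: e_def)
    also have "\<dots> \<le> c"
      unfolding c_def \<Phi>_def
    proof (intro integral_mono K_stat_integrable_mu W)
      show "n * (t - 1 / a2) * indicator {ereal a2..} a \<le> K_stat M a W" for a
        using K2 K_stat_mono[OF W, of "ereal a2" a] KW0[of a] by (auto simp: indicator_def)
    qed (auto simp: mu.emeasure_eq_measure)
    finally show ?thesis .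
  qed
  have c_le: "c \<le> n * t"
    unfolding c_def \<Phi>_def
    using integral_mono[OF K_stat_integrable_mu[OF W], of "\<lambda>_. n * t"] KW1 by (simp add: mu.prob_space)
  define X where "X = two_valued A (n * t - c) (- c)"
  have X_eq: "X = (\<lambda>\<omega>. W \<omega> - c)"
    by (auto simp: X_def W_def two_valued_def)
  have X: "X \<in> Linf M" by (simp add: X_def Linf_two_valued A)
  have KX: "K_stat M a X = K_stat M a W - c" for a
    unfolding X_eq by (rule K_stat_diff_const[OF W])
  have PX: "\<Phi> X = 0"
    unfolding X_eq Phi_diff_const[OF W] by (simp add: c_def)
  obtain Z where Z: "Z \<in> Linf M" and mix: "is_mixture M l X (\<lambda>_. 0) Z"
    using mixture_two_valued_exists[OF A(1) nonatomic] l unfolding X_def by (metis less_imp_le)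
  note KZ = is_mixture_K_stat_0[OF mix l(1,2) X Z]
  have KX_a1: "K_stat M a X \<le> - (n * e / 2)" if "a \<le> ereal a1" for a
  proof -
    have "n * (e / 2) = n * e / 2" by simp
    then show ?thesis
      using K_stat_mono[OF W that] K1 n1 c_ge unfolding KX by linarith
  qed
  have ne: "0 < n * e" using n0 e by simp
  \<comment> \<open>Pointwise in \<open>a\<close>, mixing gains at least \<open>n * e / 4\<close> on
    the interval from 0 to \<open>a1\<close>, up to a loss of at most \<open>- ln l / a1\<close>
    anywhere. On that interval \<open>K_stat M a Z\<close> is bounded below by the mean of
    \<open>Z\<close>. For negative \<open>a\<close> the statistic of \<open>X\<close> is nonpositive
    and mixing raises it. Above \<open>a1\<close>, for finite parameters, dropping the summand
    \<open>1 - l\<close> bounds the loss.\<close>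
  have diff: "n * e / 4 * indicator {0..ereal a1} a + ln l / a1 \<le> K_stat M a Z - K_stat M a X" for a
  proof -
    have neg: "ln l / a1 < 0" using lnl a1 by (simp add: divide_neg_pos)
    consider "0 \<le> a" "a \<le> ereal a1" | "a < 0" | "ereal a1 < a" by force
    then show ?thesis
    proof cases
      case 1
      have "- (n * t) \<le> K_stat M 0 X" using KX[of 0] KW0[of 0] c_le by simp
      then have "l * (- (n * t)) \<le> K_stat M 0 Z"
        unfolding KZ using l by (intro mult_left_mono) auto
      moreover have "n * (l * t) \<le> n * (e / 4)"
        using l n0 by (intro mult_left_mono) auto
      ultimately have "- (n * e / 4) \<le> K_stat M a Z"
        using K_stat_mono[OF Z 1(1)] by (simp add: algebra_simps)
      then show ?thesis using KX_a1[OF 1(2)] neg 1 by simp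
    next
      case 2
      have k: "K_stat M a X \<le> 0"
        using KX_a1[of a] ne 2 a1 by (metis ereal_less_eq(3) less_imp_le order_trans zero_ereal_def neg_le_0_iff_le half_gt_zero)
      have "K_stat M a X \<le> K_stat M a Z"
      proof (cases a)
        case (real r)
        let ?k = "K_stat M (ereal r) X"
        have r: "r < 0" using 2 real by simp
        have "1 \<le> exp (r * ?k)" using r k real by (simp add: mult_nonpos_nonpos)
        then have "(1 - l) * 1 + l * exp (r * ?k) \<le> (1 - l) * exp (r * ?k) + l * exp (r * ?k)"
          using l by (intro add_right_mono mult_left_mono) auto
        then have "1 - l + l * exp (r * ?k) \<le> exp (r * ?k)"
          by (simp add: algebra_simps)
        then have "ln (1 - l + l * exp (r * ?k)) \<le> ln (exp (r * ?k))"
          using l by (subst ln_le_cancel_iff) (auto intro!: add_pos_pos)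
        then show ?thesis using r real by (simp add: KZ field_simps)
      qed (use 2 k KZ in auto)
      then show ?thesis using neg 2 by (auto simp: indicator_def)
    next
      case 3
      have "K_stat M a X + ln l / a1 \<le> K_stat M a Z"
      proof (cases a)
        case (real r)
        let ?k = "K_stat M (ereal r) X"
        have r: "a1 < r" using 3 real by simp
        have "ln l + r * ?k = ln (l * exp (r * ?k))"
          using l by (simp add: ln_mult)
        also have "\<dots> \<le> ln (1 - l + l * exp (r * ?k))"
          using l by (subst ln_le_cancel_iff) (auto intro!: add_pos_pos)
        finally have "(ln l + r * ?k) / r \<le> ln (1 - l + l * exp (r * ?k)) / r"
          using r a1 by (intro divide_right_mono) auto
        then have "ln l / r + ?k \<le> ln (1 - l + l * exp (r * ?k)) / r"
          using r a1 by (simp add: add_divide_distrib)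
        moreover have "ln l / a1 \<le> ln l / r"
          using r a1 lnl by (intro divide_left_mono_neg) auto
        ultimately show ?thesis using r a1 real by (simp add: KZ)
      qed (use 3 neg KZ in auto)
      then show ?thesis using 3 by (auto simp: indicator_def)
    qed
  qed
  have "n * e / 4 * ?p1 + ln l / a1 = (\<integral>a. n * e / 4 * indicator {0..ereal a1} a + ln l / a1 \<partial>\<mu>)"
    by (subst Bochner_Integration.integral_add) (auto simp: mu.emeasure_eq_measure mu.prob_space)
  also have "\<dots> \<le> (\<integral>a. K_stat M a Z - K_stat M a X \<partial>\<mu>)"
    using diff by (intro integral_mono Bochner_Integration.integrable_diff K_stat_integrable_mu X Z)
      (auto simp: mu.emeasure_eq_measure)
  also have "\<dots> = \<Phi> Z - \<Phi> X"
    using X Z by (simp add: \<Phi>_def K_stat_integrable_mu)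
  also have "\<dots> = 0"
    using Phi_mixture_0[OF mix l(1,2) X Z PX] PX by simp
  finally show False using n2 by (simp add: algebra_simps)
qed

end

section \<open>The two-atom case\<close>

context betweenness_K_integral
begin

lemma K_integral_reflect: "betweenness_K_integral M (distr \<mu> borel uminus)"
proof (intro betweenness_K_integral.intro betweenness_K_integral_axioms.intro)
  have [measurable]: "uminus \<in> measurable \<mu> (borel :: ereal measure)" by measurable
  show "prob_space M" by unfold_locales
  show "prob_space (distr \<mu> borel uminus)"
    by (rule mu.prob_space_distr) simp
  have "(\<integral>a. K_stat M a X \<partial>distr \<mu> borel uminus) = - \<Phi> (\<lambda>\<omega>. - X \<omega>)" if X: "X \<in> Linf M" for X
  proof -
    have "(\<lambda>a. K_stat M a X) \<in> borel_measurable borel"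
      by (intro borel_measurable_mono_ereal monoI K_stat_mono X)
    then show ?thesis
      by (simp add: integral_distr \<Phi>_def K_stat_uminus)
  qed
  then show "betweenness_functional M (\<lambda>X. \<integral>a. K_stat M a X \<partial>distr \<mu> borel uminus)"
    using betweenness_functional_reflect[OF Phi_between]
    by (subst betweenness_functional_cong) auto
qed (use nonatomic in auto)

text \<open>Take \<open>c\<close> as the infimum of the points at which mass starts to accumulate
  from 0, with value \<infinity> if there are none. Mass below \<open>c\<close> is excluded by
  definition and mass above \<open>c\<close> by \<open>no_mass_gap\<close>.\<close>

lemma AE_nonneg_eq_point: "\<exists>c\<ge>0. AE a in \<mu>. 0 \<le> a \<longrightarrow> a = c"
proof -
  define c where "c = Inf {x. 0 \<le> x \<and> measure \<mu> {0..x} \<noteq> 0}"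
  have c0: "0 \<le> c"
    unfolding c_def by (rule Inf_greatest) auto
  have null: "AE a in \<mu>. a \<notin> S" if "measure \<mu> S = 0" "S \<in> sets borel" for S
    using that by (subst mu.prob_eq_0[symmetric]) (auto simp: sets_mu)
  have below: "AE a in \<mu>. \<not> (0 \<le> a \<and> a \<le> x)" if "x < c" for x
  proof (cases "0 \<le> x")
    case True
    have "measure \<mu> {0..x} = 0"
      using that True Inf_lower[of x "{x. 0 \<le> x \<and> measure \<mu> {0..x} \<noteq> 0}"]
      unfolding c_def by (auto simp: not_le[symmetric])
    from null[OF this] show ?thesis by simp
  qed auto
  have above: "AE a in \<mu>. \<not> x \<le> a" if x: "c < x" for x
  proof -
    from x obtain y where y: "0 \<le> y" "measure \<mu> {0..y} \<noteq> 0" "y < x"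
      unfolding c_def by (auto simp: Inf_less_iff)
    \<comment> \<open>Two real thresholds are inserted because \<open>y\<close> and \<open>x\<close>
      are extended reals and the gap lemma needs a strict gap between real ones.\<close>
    obtain a2 where a2: "y < ereal a2" "ereal a2 < x"
      using ereal_dense2[OF y(3)] by blast
    obtain a1 where a1: "y < ereal a1" "ereal a1 < ereal a2"
      using ereal_dense2[OF a2(1)] by blast
    have "measure \<mu> {0..y} \<le> measure \<mu> {0..ereal a1}"
      using a1 by (intro mu.finite_measure_mono) (auto simp: sets_mu)
    with y have "measure \<mu> {0..ereal a1} \<noteq> 0"
      using measure_nonneg[of \<mu> "{0..y}"] by linarith
    moreover have "0 < a1"
      using y(1) a1(1) by (cases y) auto
    ultimately have "measure \<mu> {ereal a2..} = 0"
      using no_mass_gap[of a1 a2] a1 by auto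
    from null[OF this] show ?thesis
      using a2 by (auto elim!: eventually_mono)
  qed
  \<comment> \<open>Rational thresholds suffice to separate \<open>a\<close> from \<open>c\<close>,
    and countably many null sets can be united.\<close>
  have "AE a in \<mu>. \<forall>r::rat. (ereal (of_rat r) < c \<longrightarrow> \<not> (0 \<le> a \<and> a \<le> ereal (of_rat r))) \<and>
      (c < ereal (of_rat r) \<longrightarrow> \<not> ereal (of_rat r) \<le> a)"
    using below above by (simp add: AE_all_countable)
  then have "AE a in \<mu>. 0 \<le> a \<longrightarrow> a = c"
  proof (rule eventually_mono, intro impI)
    fix a :: ereal
    assume *: "\<forall>r::rat. (ereal (of_rat r) < c \<longrightarrow> \<not> (0 \<le> a \<and> a \<le> ereal (of_rat r))) \<and>
      (c < ereal (of_rat r) \<longrightarrow> \<not> ereal (of_rat r) \<le> a)" and a: "0 \<le> a"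
    show "a = c"
    proof (rule ccontr)
      assume "a \<noteq> c"
      then consider "a < c" | "c < a" by force
      then show False
      proof cases
        case 1
        then obtain r where "a < ereal (of_rat r)" "ereal (of_rat r) < c"
          using ereal_dense3 by blast
        then show ?thesis using * a by (meson less_imp_le)
      next
        case 2
        then obtain r where "c < ereal (of_rat r)" "ereal (of_rat r) < a"
          using ereal_dense3 by blast
        then show ?thesis using * by (meson less_imp_le)
      qed
    qed
  qed
  with c0 show ?thesis by blast
qed

lemma AE_nonpos_eq_point: "\<exists>b\<le>0. AE a in \<mu>. a \<le> 0 \<longrightarrow> a = b"
proof -
  interpret R: betweenness_K_integral M "distr \<mu> borel uminus"
    by (rule K_integral_reflect)
  have m: "uminus \<in> measurable \<mu> (borel :: ereal measure)" by measurable
  obtain c where c: "0 \<le> c" "AE a in distr \<mu> borel uminus. 0 \<le> a \<longrightarrow> a = c"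
    using R.AE_nonneg_eq_point by blast
  have "AE a in \<mu>. 0 \<le> - a \<longrightarrow> - a = c"
    using c(2) by (subst (asm) AE_distr_iff[OF m]) auto
  then have "AE a in \<mu>. a \<le> 0 \<longrightarrow> a = - c"
    by (auto elim!: eventually_mono)
  with c show ?thesis by (intro exI[of _ "- c"]) auto
qed

lemma AE_0_or_two_points:
  obtains "AE a in \<mu>. a = 0" | b c where "b < 0" "0 < c" "AE a in \<mu>. a = b \<or> a = c"
proof -
  obtain c where c: "0 \<le> c" "AE a in \<mu>. 0 \<le> a \<longrightarrow> a = c"
    using AE_nonneg_eq_point by blast
  obtain b where b: "b \<le> 0" "AE a in \<mu>. a \<le> 0 \<longrightarrow> a = b"
    using AE_nonpos_eq_point by blast
  from b(2) c(2) have AE: "AE a in \<mu>. (a \<le> 0 \<longrightarrow> a = b) \<and> (0 \<le> a \<longrightarrow> a = c)"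
    by auto
  consider "b = 0" "c = 0" | "b = 0" "0 < c" | "b < 0" "c = 0" | "b < 0" "0 < c"
    using b c by force
  then show thesis
  proof cases
    case 1
    have "AE a in \<mu>. a = 0"
      using AE by eventually_elim (use 1 linear in blast)
    then show ?thesis by (rule that(1))
  next
    case 2
    \<comment> \<open>The point 0 lies in both half-lines, so mass at 0 would force
      \<open>c = 0\<close>. Only \<open>c\<close> carries mass, and -1 is an arbitrary negative
      placeholder.\<close>
    have "AE a in \<mu>. a = -1 \<or> a = c"
      using AE by eventually_elim (use 2 linear in \<open>metis less_irrefl\<close>)
    then show ?thesis using 2 by (intro that(2)[of "-1" c]) auto
  next
    case 3
    have "AE a in \<mu>. a = b \<or> a = 1"
      using AE by eventually_elim (use 3 linear in \<open>metis less_irrefl\<close>)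
    then show ?thesis using 3 by (intro that(2)[of b 1]) auto
  next
    case 4
    have "AE a in \<mu>. a = b \<or> a = c"
      using AE by eventually_elim (use linear in blast)
    then show ?thesis using 4 by (intro that(2)[of b c]) auto
  qed
qed

lemma Phi_cases:
  obtains "\<And>X. X \<in> Linf M \<Longrightarrow> \<Phi> X = K_stat M 0 X"
  | \<beta> b c where "0 \<le> \<beta>" "\<beta> \<le> 1" "b < 0" "0 < c"
      "\<And>X. X \<in> Linf M \<Longrightarrow> \<Phi> X = \<beta> * K_stat M b X + (1 - \<beta>) * K_stat M c X"
proof (rule AE_0_or_two_points)
  assume AE: "AE a in \<mu>. a = 0"
  have "\<Phi> X = K_stat M 0 X" if X: "X \<in> Linf M" for X
  proof -
    have "\<Phi> X = (\<integral>a. K_stat M 0 X \<partial>\<mu>)"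
      unfolding \<Phi>_def using AE by (intro integral_cong_AE K_stat_measurable_mu X) (auto elim!: eventually_mono)
    then show ?thesis by (simp add: mu.prob_space)
  qed
  then show thesis by (rule that(1))
next
  fix b c :: ereal assume bc: "b < 0" "0 < c" and AE: "AE a in \<mu>. a = b \<or> a = c"
  define \<beta> where "\<beta> = measure \<mu> {b}"
  have meas [measurable]: "{b} \<in> sets \<mu>" by (simp add: sets_mu)
  have "\<Phi> X = \<beta> * K_stat M b X + (1 - \<beta>) * K_stat M c X" if X: "X \<in> Linf M" for X
  proof -
    have "\<Phi> X = (\<integral>a. K_stat M c X + (K_stat M b X - K_stat M c X) * indicator {b} a \<partial>\<mu>)"
      unfolding \<Phi>_def
      using AE bc by (intro integral_cong_AE K_stat_measurable_mu X) (auto elim!: eventually_mono)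
    also have "\<dots> = K_stat M c X + (K_stat M b X - K_stat M c X) * \<beta>"
      using meas by (subst Bochner_Integration.integral_add)
        (auto simp: mu.prob_space \<beta>_def mu.emeasure_eq_measure)
    finally show ?thesis by (simp add: algebra_simps)
  qed
  then show thesis
    using bc by (intro that(2)[of \<beta> b c]) (auto simp: \<beta>_def)
qed

end

section \<open>Functionals carried by two parameters of opposite sign\<close>

context prob_space
begin

text \<open>A fair coin separates negative from positive parameters. For finite \<open>c\<close>,
  strictness comes from \<open>0 < (y - 1)\<^sup>2\<close> with
  \<open>y = exp (r / 2)\<close>.\<close>

lemma K_stat_two_valued_half:
  assumes A: "A \<in> sets M" "prob A = 1 / 2"
  shows "K_stat M \<infinity> (two_valued A 1 0) = 1"
    and "b \<le> 0 \<Longrightarrow> K_stat M b (two_valued A 1 0) \<le> 1 / 2"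
    and "0 < c \<Longrightarrow> 1 / 2 < K_stat M c (two_valued A 1 0)"
proof -
  let ?W = "two_valued A 1 0"
  have W: "?W \<in> Linf M" by (simp add: Linf_two_valued A)
  show inf: "K_stat M \<infinity> ?W = 1"
    using A by (simp add: K_stat_infty ess_max_two_valued)
  have K0: "K_stat M 0 ?W = 1 / 2"
    using expectation_two_valued[OF A(1), of "\<lambda>x. x" 1 0] A by (simp add: K_stat_0)
  show "K_stat M b ?W \<le> 1 / 2" if "b \<le> 0"
    using K_stat_mono[OF W that] K0 by simp
  show "1 / 2 < K_stat M c ?W" if "0 < c"
  proof (cases c)
    case (real r)
    then have r: "0 < r" using that by simp
    define y where "y = exp (r / 2)"
    have "exp r = y\<^sup>2" "y \<noteq> 1"
      using r by (simp_all add: y_def exp_double[symmetric])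
    then have "0 < (y - 1)\<^sup>2" by simp
    then have "y < 1 / 2 * exp r + 1 / 2"
      unfolding \<open>exp r = y\<^sup>2\<close> by (simp add: power2_eq_square algebra_simps)
    also have "\<dots> = mgf ?W r"
      by (simp add: mgf_two_valued[OF A(1)] A)
    also have "\<dots> = exp (r * K_stat M (ereal r) ?W)"
      by (rule exp_K_stat[OF W, symmetric])
    finally show ?thesis
      using r real by (simp add: y_def)
  qed (use that inf in auto)
qed

text \<open>A fair coin recentred at its \<Psi>-value: its two statistics differ and their weighted
  sum is 0, so they have opposite signs.\<close>

lemma two_point_test:
  assumes na: "nonatomic M" and btw: "betweenness_functional M \<Psi>"
    and form: "\<And>X. X \<in> Linf M \<Longrightarrow> \<Psi> X = \<beta> * K_stat M b X + (1 - \<beta>) * K_stat M c X"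
    and \<beta>: "0 < \<beta>" "\<beta> < 1" and bc: "b < 0" "0 < c"
  obtains X where "X \<in> Linf M" "\<Psi> X = 0" "K_stat M b X < 0" "0 < K_stat M c X"
    "\<And>l. 0 < l \<Longrightarrow> l < 1 \<Longrightarrow> \<exists>Z\<in>Linf M. is_mixture M l X (\<lambda>_. 0) Z \<and> \<Psi> Z = 0"
proof -
  obtain A where A: "A \<in> sets M" "prob A = 1 / 2"
    using nonatomic_subset_prob[OF na, of "space M" "1 / 2"] by (auto simp: prob_space)
  define W where "W = two_valued A 1 0"
  have W: "W \<in> Linf M" by (simp add: W_def Linf_two_valued A)
  define d where "d = \<Psi> W"
  define X where "X = two_valued A (1 - d) (- d)"
  have X_eq: "X = (\<lambda>\<omega>. W \<omega> - d)"
    by (auto simp: X_def W_def two_valued_def)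
  have X: "X \<in> Linf M" by (simp add: X_def Linf_two_valued A)
  have KX: "K_stat M a X = K_stat M a W - d" for a
    unfolding X_eq by (rule K_stat_diff_const[OF W])
  have PX: "\<Psi> X = 0"
    using form[OF X] form[OF W] by (simp add: KX d_def algebra_simps)
  have "K_stat M b W < K_stat M c W"
    using K_stat_two_valued_half(2)[OF A, of b] K_stat_two_valued_half(3)[OF A, of c] bc
    unfolding W_def by (meson le_less_trans less_imp_le)
  then have less: "K_stat M b X < K_stat M c X" by (simp add: KX)
  have sum: "\<beta> * K_stat M b X + (1 - \<beta>) * K_stat M c X = 0" using form[OF X] PX by simp
  have neg: "K_stat M b X < 0"
  proof (rule ccontr)
    assume "\<not> K_stat M b X < 0"
    then have "0 \<le> \<beta> * K_stat M b X" "0 < (1 - \<beta>) * K_stat M c X"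
      using less \<beta> by auto
    then show False using sum by linarith
  qed
  then have "\<beta> * K_stat M b X < 0" using \<beta> by (simp add: mult_pos_neg)
  then have "0 < (1 - \<beta>) * K_stat M c X" using sum by linarith
  then have pos: "0 < K_stat M c X" using \<beta> by (simp add: zero_less_mult_iff)
  have "\<exists>Z\<in>Linf M. is_mixture M l X (\<lambda>_. 0) Z \<and> \<Psi> Z = 0" if l: "0 < l" "l < 1" for l
  proof -
    obtain Z where Z: "Z \<in> Linf M" and mix: "is_mixture M l X (\<lambda>_. 0) Z"
      using mixture_two_valued_exists[OF A(1) na] l unfolding X_def by (metis less_imp_le)
    have "\<Psi> (\<lambda>_. 0) = 0" using form[OF Linf_const] by simp
    then have "\<Psi> Z = 0"
      using betweenness_functionalD[OF btw mix l X Linf_const Z] PX by simp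
    with Z mix show ?thesis by blast
  qed
  with X PX neg pos show thesis by (rule that)
qed

text \<open>Mixing with 0 does not change a positive essential maximum. If only the extremes matter,
  a mixture is indifferent to \<open>?Y\<close> although 0 is not. If \<open>b\<close> is finite
  with positive weight, its statistic would have to be unchanged as well, which makes the moment
  generating function equal to 1 and contradicts \<open>K_stat M b X < 0\<close>.\<close>

lemma betweenness_weight_infty:
  assumes na: "nonatomic M" and btw: "betweenness_functional M \<Psi>"
    and form: "\<And>X. X \<in> Linf M \<Longrightarrow> \<Psi> X = \<beta> * K_stat M b X + (1 - \<beta>) * K_stat M \<infinity> X"
    and \<beta>: "0 \<le> \<beta>" "\<beta> \<le> 1" and b: "b < 0"
  shows "\<beta> = 1"
proof (rule ccontr)
  assume "\<beta> \<noteq> 1"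
  then have \<beta>1: "\<beta> < 1" using \<beta> by simp
  show False
  proof (cases "\<beta> = 0 \<or> b = - \<infinity>")
    case True
    \<comment> \<open>If \<open>\<beta> = 0\<close> the parameter \<open>b\<close> has no weight and
      may be replaced by minus infinity.\<close>
    have form': "\<Psi> X = \<beta> * K_stat M (- \<infinity>) X + (1 - \<beta>) * K_stat M \<infinity> X" if "X \<in> Linf M" for X
      using form[OF that] True by auto
    obtain A where A: "A \<in> sets M" "prob A = 1 / 2"
      using nonatomic_subset_prob[OF na, of "space M" "1 / 2"] by (auto simp: prob_space)
    \<comment> \<open>Solves \<open>- \<beta> + (1 - \<beta>) * v = 1\<close>, giving
      \<open>?Y\<close> the value 1 with 0 between its two outcomes.\<close>
    define v where "v = (1 + \<beta>) / (1 - \<beta>)"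
    have v: "0 \<le> v" "(1 - \<beta>) * v = 1 + \<beta>"
      using \<beta> \<beta>1 by (auto simp: v_def)
    let ?Y = "two_valued A v (- 1)"
    have Y: "?Y \<in> Linf M" by (simp add: Linf_two_valued A)
    have Kp: "K_stat M \<infinity> ?Y = v"
      using A v by (simp add: K_stat_infty ess_max_two_valued)
    have "(\<lambda>\<omega>. - ?Y \<omega>) = two_valued A (- v) 1" by (auto simp: two_valued_def)
    moreover have "K_stat M \<infinity> (two_valued A (- v) 1) = 1"
      using A v by (simp add: K_stat_infty ess_max_two_valued)
    ultimately have Km: "K_stat M (- \<infinity>) ?Y = - 1"
      using K_stat_uminus[of \<infinity> ?Y] by simp
    have PY: "\<Psi> ?Y = 1"
      using form'[OF Y] Kp Km v by simp
    obtain Z where Z: "Z \<in> Linf M" and mix: "is_mixture M (1 / 2) ?Y (\<lambda>_. 0) Z"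
      using mixture_two_valued_exists[OF A(1) na, of "1 / 2"] by auto
    note KZ = is_mixture_K_stat_0[OF mix _ _ Y Z, simplified]
    have "\<Psi> Z = 1"
      using form'[OF Z] PY form'[OF Y] Kp Km v by (simp add: KZ)
    \<comment> \<open>Seen as a mixture of 0 with \<open>?Y\<close>, the variable \<open>Z\<close>
      is indifferent to \<open>?Y\<close>, so betweenness would force 0 to be so too.\<close>
    moreover have "is_mixture M (1 / 2) (\<lambda>_. 0) ?Y Z"
      using is_mixture_swap[OF mix] by simp
    ultimately have "\<Psi> (\<lambda>_. 0) = 1"
      using betweenness_functionalD[OF btw _ _ _ Linf_const Y Z] PY by simp
    then show False using form[OF Linf_const] by simp
  next
    case False
    then obtain r where r: "b = ereal r" "r < 0" using b by (cases b) auto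
    have "0 < \<beta>" using False \<beta> by simp
    from two_point_test[OF na btw form this \<beta>1 b]
    obtain X where X: "X \<in> Linf M" "\<Psi> X = 0" "K_stat M b X < 0" "0 < K_stat M \<infinity> X"
      and Xmix: "\<And>l. 0 < l \<Longrightarrow> l < 1 \<Longrightarrow> \<exists>Z\<in>Linf M. is_mixture M l X (\<lambda>_. 0) Z \<and> \<Psi> Z = 0"
      by auto
    obtain Z where Z: "Z \<in> Linf M" "is_mixture M (1 / 2) X (\<lambda>_. 0) Z" "\<Psi> Z = 0"
      using Xmix[of "1 / 2"] by auto
    note KZ = is_mixture_K_stat_0[OF Z(2) _ _ X(1) Z(1)]
    have eq: "K_stat M \<infinity> Z = K_stat M \<infinity> X" using X by (simp add: KZ)
    have "\<beta> * K_stat M b Z = \<beta> * K_stat M b X"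
      using form[OF X(1)] form[OF Z(1)] unfolding eq X(2) Z(3) by linarith
    then have "K_stat M b Z = K_stat M b X" using \<open>0 < \<beta>\<close> by simp
    then have "mgf Z r = mgf X r"
      using exp_K_stat[OF X(1), of r] exp_K_stat[OF Z(1), of r] r by simp
    moreover have "mgf Z r = 1 / 2 * mgf X r + 1 / 2"
      using is_mixture_mgf[OF Z(2) _ _ X(1) Linf_const Z(1), of r] by (simp add: prob_space)
    ultimately have "mgf X r = 1" by simp
    then show False using X(3) r by (simp add: K_stat_real)
  qed
qed

text \<open>The \<Psi>-value of every mixture with 0 vanishes. Up to the factor \<open>b * c\<close>
  it is the function \<open>h\<close> of the weight \<open>l\<close>, whose derivative therefore
  vanishes on the open unit interval.\<close>

lemma betweenness_two_points:
  assumes na: "nonatomic M" and btw: "betweenness_functional M \<Psi>"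
    and form: "\<And>X. X \<in> Linf M \<Longrightarrow> \<Psi> X = \<beta> * K_stat M (ereal b) X + (1 - \<beta>) * K_stat M (ereal c) X"
    and \<beta>: "0 < \<beta>" "\<beta> < 1" and bc: "b < 0" "0 < c"
  shows "\<beta> * c + (1 - \<beta>) * b = 0"
proof -
  have "ereal b < 0" "0 < ereal c" using bc by auto
  from two_point_test[OF na btw form \<beta> this]
  obtain X where X: "X \<in> Linf M" "K_stat M b X < 0" "0 < K_stat M c X"
    and Xmix: "\<And>l. 0 < l \<Longrightarrow> l < 1 \<Longrightarrow> \<exists>Z\<in>Linf M. is_mixture M l X (\<lambda>_. 0) Z \<and> \<Psi> Z = 0"
    by metis
  define u where "u = exp (b * K_stat M b X) - 1"
  define v where "v = exp (c * K_stat M c X) - 1"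
  have uv: "0 < u" "0 < v" using X bc by (auto simp: u_def v_def mult_neg_neg)
  define h where "h l = \<beta> * c * ln (1 + l * u) + (1 - \<beta>) * b * ln (1 + l * v)" for l
  have h0: "h l = 0" if l: "l \<in> {0<..<1}" for l
  proof -
    obtain Z where Z: "Z \<in> Linf M" "is_mixture M l X (\<lambda>_. 0) Z" "\<Psi> Z = 0"
      using Xmix[of l] l by auto
    have KZ: "K_stat M (ereal r) Z = ln (1 + l * (exp (r * K_stat M (ereal r) X) - 1)) / r" if "r \<noteq> 0" for r
      using is_mixture_K_stat_0(1)[OF Z(2) _ _ X(1) Z(1) that] l by (simp add: algebra_simps)
    have "\<beta> * (ln (1 + l * u) / b) + (1 - \<beta>) * (ln (1 + l * v) / c) = 0"
      using form[OF Z(1)] Z(3) KZ[of b] KZ[of c] bc by (simp add: u_def v_def)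
    moreover have "h l = b * c * (\<beta> * (ln (1 + l * u) / b) + (1 - \<beta>) * (ln (1 + l * v) / c))"
      using bc by (simp add: h_def distrib_left)
    ultimately show ?thesis by simp
  qed
  have deriv: "\<beta> * c * u * (1 + l * v) + (1 - \<beta>) * b * v * (1 + l * u) = 0" if l: "l \<in> {0<..<1}" for l
  proof -
    have pos: "0 < 1 + l * u" "0 < 1 + l * v" using l uv by (auto intro!: add_pos_pos)
    have ln_deriv: "((\<lambda>x. ln (1 + x * w)) has_real_derivative w / (1 + l * w)) (at l)"
      if "0 < 1 + l * w" for w
      using that by (auto intro!: derivative_eq_intros)
    have "(h has_real_derivative (\<beta> * c * (u / (1 + l * u)) + (1 - \<beta>) * b * (v / (1 + l * v)))) (at l)"
      unfolding h_def[abs_def] by (intro DERIV_add DERIV_cmult ln_deriv pos)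
    moreover have "(h has_real_derivative 0) (at l)"
      using DERIV_const[of 0] by (rule has_field_derivative_transform_within_open[of _ _ _ "{0<..<1}"]) (use l h0 in auto)
    ultimately have "\<beta> * c * (u / (1 + l * u)) + (1 - \<beta>) * b * (v / (1 + l * v)) = 0"
      by (rule DERIV_unique)
    moreover have "A * u * q + B * v * p = p * q * (A * (u / p) + B * (v / q))"
      if "0 < p" "0 < q" for A B p q :: real
      using that by (simp add: field_simps)
    ultimately show ?thesis
      using pos by (metis mult_zero_right)
  qed
  \<comment> \<open>After clearing denominators the derivative condition is affine in
    \<open>l\<close>; vanishing at two weights annihilates the coefficient of
    \<open>l\<close>.\<close>
  have "u * v * (\<beta> * c + (1 - \<beta>) * b) = 0"
    using deriv[of "1/2"] deriv[of "1/3"] by (simp add: algebra_simps)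
  then show ?thesis using uv by simp
qed

end

section \<open>Characterisation of betweenness for integrals of the statistics K_a\<close>

theorem theorem4:
  fixes M :: "'a measure"
    and \<mu> :: "ereal measure"
    and \<Phi> :: "('a \<Rightarrow> real) \<Rightarrow> real"
    and pref :: "('a \<Rightarrow> real) \<Rightarrow> ('a \<Rightarrow> real) \<Rightarrow> bool"
  assumes "prob_space M" and "nonatomic M"
    and "prob_space \<mu>" and "sets \<mu> = sets borel"
    and "monotone_additive_statistic M \<Phi>"
    and "\<And>X. X \<in> Linf M \<Longrightarrow> \<Phi> X = (\<integral>a. K_stat M a X \<partial>\<mu>)"
    and "represented_by M pref \<Phi>"
  shows "betweenness M pref \<longleftrightarrow>
    (\<exists>\<beta>\<in>{0..1}. \<exists>a::real. 0 \<le> a \<and>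
      (\<forall>X\<in>Linf M. \<Phi> X =
         \<beta> * K_stat M (ereal (- a * \<beta>)) X +
         (1 - \<beta>) * K_stat M (ereal (a * (1 - \<beta>))) X))"
    (is "_ \<longleftrightarrow> ?R")
proof
  interpret prob_space M by fact
  assume "betweenness M pref"
  then have btw: "betweenness_functional M \<Phi>"
    using betweenness_iff_functional[OF assms(7)] by simp
  then have "betweenness_functional M (\<lambda>X. \<integral>a. K_stat M a X \<partial>\<mu>)"
    using betweenness_functional_cong[OF assms(6), of M "\<lambda>X. X"] by simp
  then interpret K: betweenness_K_integral M \<mu>
    using assms by (intro betweenness_K_integral.intro betweenness_K_integral_axioms.intro)
  have Phi: "\<Phi> X = K.\<Phi> X" if "X \<in> Linf M" for X
    using assms(6)[OF that] by (simp add: K.\<Phi>_def)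
  show ?R
  proof (rule K.Phi_cases)
    assume "\<And>X. X \<in> Linf M \<Longrightarrow> K.\<Phi> X = K_stat M 0 X"
    then show ?R
      using Phi by (intro bexI[of _ 0] exI[of _ 0]) (auto simp: zero_ereal_def[symmetric])
  next
    fix \<beta> b c
    assume \<beta>: "0 \<le> \<beta>" "\<beta> \<le> 1" and bc: "b < 0" "0 < c"
      and "\<And>X. X \<in> Linf M \<Longrightarrow> K.\<Phi> X = \<beta> * K_stat M b X + (1 - \<beta>) * K_stat M c X"
    then have form: "\<Phi> X = \<beta> * K_stat M b X + (1 - \<beta>) * K_stat M c X" if "X \<in> Linf M" for X
      using that Phi by simp
    have c_fin: "\<beta> = 1" if "c = \<infinity>"
      using betweenness_weight_infty[OF assms(2) btw _ \<beta> bc(1)] form that by simp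
    \<comment> \<open>The reflected functional puts weight \<open>1 - \<beta>\<close> on
      \<open>- c\<close> and weight \<open>\<beta>\<close> on \<infinity>, so the result on infinite
      atoms applies with \<open>1 - \<beta>\<close> in place of \<open>\<beta>\<close>.\<close>
    have b_fin: "\<beta> = 0" if b: "b = - \<infinity>"
    proof -
      have "- \<Phi> (\<lambda>\<omega>. - X \<omega>) = (1 - \<beta>) * K_stat M (- c) X + (1 - (1 - \<beta>)) * K_stat M \<infinity> X"
        if "X \<in> Linf M" for X
        using form[OF Linf_uminus[OF that]] b by (simp add: K_stat_uminus)
      from betweenness_weight_infty[OF assms(2) betweenness_functional_reflect[OF btw] this]
      have "1 - \<beta> = 1" using \<beta> bc by (simp add: ereal_uminus_less_reorder)
      then show ?thesis by simp
    qed
    consider "\<beta> = 0" | "\<beta> = 1" | "0 < \<beta>" "\<beta> < 1" using \<beta> by linarith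
    then show ?R
    proof cases
      case 1
      then obtain r where "c = ereal r" "0 < r" using c_fin bc by (cases c) auto
      then show ?R using 1 form by (intro bexI[of _ 0] exI[of _ r]) auto
    next
      case 2
      then obtain r where "b = ereal r" "r < 0" using b_fin bc by (cases b) auto
      then show ?R using 2 form by (intro bexI[of _ 1] exI[of _ "- r"]) auto
    next
      case 3
      then obtain r s where rs: "b = ereal r" "r < 0" "c = ereal s" "0 < s"
        using b_fin c_fin bc by (cases b; cases c) auto
      have eq: "\<beta> * s + (1 - \<beta>) * r = 0"
        using betweenness_two_points[OF assms(2) btw _ 3 rs(2,4)] form rs by simp
      \<comment> \<open>The weight equation says precisely that \<open>a = s - r\<close> recovers
        both parameters.\<close>
      have "- (s - r) * \<beta> = r" "(s - r) * (1 - \<beta>) = s"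
        using eq by (simp_all add: algebra_simps)
      then show ?R
        using \<beta> form rs by (intro bexI[of _ \<beta>] exI[of _ "s - r"]) auto
    qed
  qed
next
  interpret prob_space M by fact
  assume ?R
  then obtain \<beta> a where a: "0 \<le> a"
    and "\<And>X. X \<in> Linf M \<Longrightarrow> \<Phi> X =
      \<beta> * K_stat M (ereal (- a * \<beta>)) X + (1 - \<beta>) * K_stat M (ereal (a * (1 - \<beta>))) X"
    by blast
  then show "betweenness M pref"
    using K_stat_pair_betweenness[OF a, of \<beta>] betweenness_iff_functional[OF assms(7)]
      betweenness_functional_cong[of M \<Phi>] by simp
qed

end
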